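(* Suppose that there are a constant $L_1\in\mathbb R$ and constants $L_2,L_3>0$ such that for all $x,y\in\mathbb R^d$ $$2\langle b(x)-b(y),x-y\rangle+\|\sigma(x)-\sigma(y)\|^2\le L_1|x-y|^2,\qquad 2\langle b(x),x\rangle+\|\sigma(x)\|^2\le L_2-L_3|x|^2,$$ that for each $x\in\mathbb R^d$ the matrix $\sigma(x)\sigma(x)^\top\in\mathbb R^{d\times d}$ is positive definite, and that $b$ and $x\mapsto[\sigma(x)\sigma(x)^\top]^{-1}$ are continuously differentiable. Let $\tau\in(0,1)$ and $\theta\in[1/2,1]$ with $L_1\theta\tau<2$, and let $(X_n)_{n\in\mathbb N}$ be the Markov chain generated by the stochastic theta method with parameter $\theta$ and step size $\tau$. (a) If $\theta=1/2$, then $(X_n)_{n\in\mathbb N}$ is uniquely ergodic. (b) If $\theta\in(1/2,1]$, then $(X_n)_{n\in\mathbb N}$ is geometrically ergodic with respect to its unique invariant probability measure $\pi_\tau^\theta$. That is, for $\lambda\in(0,2\theta-1]$ and $$V(x)=V_\theta(x):=|x-(1-\theta+\lambda)b(x)\tau|^2+(2\theta-1-\lambda)\|\sigma(x)\|^2\tau+1,\quad x\in\mathbb R^d,$$ there exist $r\in(0,1)$ and $K\in(0,\infty)$ such that for all measurable $\phi:\mathbb R^d\to\mathbb R$ with $|\phi|\le V$, $$\Big|\mathbb E\,\phi(X_n^{x_0})-\int_{\mathbb R^d}\phi(y)\,\pi_\tau^\theta(\mathrm dy)\Big|\le K r^nV(x_0),\qquad x_0\in\mathbb R^d,\ n\in\mathbb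 N.$$
   Context: Throughout, $W$ is an $\mathbb R^m$-valued standard Wiener process on a complete filtered probability space $(\Omega,\mathscr F,(\mathscr F(t))_{t\ge0},\mathbb P)$, and $b:\mathbb R^d\to\mathbb R^d$, $\sigma:\mathbb R^d\to\mathbb R^{d\times m}$ are continuous. $\langle\cdot,\cdot\rangle$ and $|\cdot|$ are the Euclidean inner product and norm; $\|\cdot\|$ is the Hilbert--Schmidt (Frobenius) norm on $\mathbb R^{d\times m}$; $\mathbb N=\{0,1,2,\dots\}$. The stochastic theta method (STM) with $\theta\in[0,1]$ and step size $\tau\in(0,1)$ for $\mathrm dX=b(X)\mathrm dt+\sigma(X)\mathrm dW$ is $$X_{j+1}=X_j+(1-\theta)b(X_j)\tau+\theta b(X_{j+1})\tau+\sigma(X_j)\delta_jW,\quad j\in\mathbb N,$$ with $\delta_jW:=W(t_{j+1})-W(t_j)$, $t_j=j\tau$. Under the first inequality of the claim and $L_1\theta\tau<2$ this recursion is uniquely solvable and $(X_n)$ is a homogeneous Markov chain. $X_n^{x_0}$ denotes the chain started at $X_0=x_0$; its transition kernel is $P(x,A)=\mathbb P(X_{n+1}\in A\mid X_n=x)$. A probability measure $\mu$ on $\mathcal B(\mathbb R^d)$ is invariant if $\int P(x,A)\mu(\mathrm dx)=\mu(A)$ for all Borel $A$. The chain is uniquely ergodic if it admits a unique invariant probability measure (which is then ergodic). *)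

theory Defs
  imports "HOL-Probability.Probability"
begin

text \<open>
  Vectors in \<open>\<real>\<^sup>d\<close> are \<open>real ^ 'd\<close>, and \<open>d \<times> m\<close> matrices are \<open>real ^ 'm ^ 'd\<close> (\<open>d\<close> rows of length
  \<open>m\<close>). On the latter type the library norm is the Hilbert--Schmidt norm, and not the
  operator norm:
\<close>

lemma norm_matrix_Hilbert_Schmidt:
  fixes A :: "real ^ 'm ^ 'd"
  shows "norm A = sqrt (\<Sum>i\<in>UNIV. \<Sum>j\<in>UNIV. (A $ i $ j)\<^sup>2)"
  by (simp add: norm_vec_def L2_set_def sum_nonneg)

definition pos_def_matrix :: "real ^ 'n ^ 'n \<Rightarrow> bool" where
  "pos_def_matrix A \<longleftrightarrow> transpose A = A \<and> (\<forall>v. v \<noteq> 0 \<longrightarrow> 0 < v \<bullet> (A *v v))"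

definition continuously_differentiable ::
    "('a::real_normed_vector \<Rightarrow> 'b::real_normed_vector) \<Rightarrow> bool" where
  "continuously_differentiable f \<longleftrightarrow>
     (\<exists>f' :: 'a \<Rightarrow> 'a \<Rightarrow>\<^sub>L 'b.
        (\<forall>x. (f has_derivative blinfun_apply (f' x)) (at x)) \<and> continuous_on UNIV f')"

text \<open>
  The time set is \<open>[0, \<infinity>)\<close>; nothing is required of \<open>F t\<close> and \<open>W t\<close> for \<open>t < 0\<close>.
\<close>

locale complete_filtered_prob_space = prob_space M + complete_measure M
  for M :: "'w measure" +
  fixes F :: "real \<Rightarrow> 'w measure"
  assumes subalgebra_F: "0 \<le> t \<Longrightarrow> subalgebra M (F t)"
    and F_mono: "0 \<le> s \<Longrightarrow> s \<le> t \<Longrightarrow> sets (F s) \<subseteq> sets (F t)"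
    and null_sets_F: "null_sets M \<subseteq> sets (F 0)"

text \<open>
  The density in \<open>increment_normal\<close> is that of the centred normal distribution with covariance
  matrix \<open>(t - s) I\<close>; the second parameter of \<open>normal_density\<close> is the standard deviation.
\<close>

locale standard_wiener_process = complete_filtered_prob_space M F
  for M :: "'w measure" and F :: "real \<Rightarrow> 'w measure" +
  fixes W :: "real \<Rightarrow> 'w \<Rightarrow> real ^ 'm"
  assumes adapted: "0 \<le> t \<Longrightarrow> W t \<in> borel_measurable (F t)"
    and start_zero: "AE \<omega> in M. W 0 \<omega> = 0"
    and increment_indep: "0 \<le> s \<Longrightarrow> s < t \<Longrightarrow>
      indep_set (sets (F s)) (sets (vimage_algebra (space M) (\<lambda>\<omega>. W t \<omega> - W s \<omega>) borel))"
    and increment_normal: "0 \<le> s \<Longrightarrow> s < t \<Longrightarrow>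
      distributed M lborel (\<lambda>\<omega>. W t \<omega> - W s \<omega>)
        (\<lambda>x. ennreal (\<Prod>i\<in>UNIV. normal_density 0 (sqrt (t - s)) (x $ i)))"
    and continuous_paths: "AE \<omega> in M. continuous_on {0..} (\<lambda>t. W t \<omega>)"

text \<open>
  The stochastic theta method started at \<open>x0\<close>. The scheme is implicit when \<open>\<theta> > 0\<close>, so it is a
  relation on processes. Equations between random variables hold almost surely.
\<close>

definition stm_process ::
    "'w measure \<Rightarrow> (real \<Rightarrow> 'w \<Rightarrow> real ^ 'm) \<Rightarrow> (real ^ 'd \<Rightarrow> real ^ 'd) \<Rightarrow>
     (real ^ 'd \<Rightarrow> real ^ 'm ^ 'd) \<Rightarrow> real \<Rightarrow> real \<Rightarrow> real ^ 'd \<Rightarrow> (nat \<Rightarrow> 'w \<Rightarrow> real ^ 'd) \<Rightarrow> bool" where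
  "stm_process M W b \<sigma> \<theta> \<tau> x0 X \<longleftrightarrow>
     (\<forall>n. X n \<in> borel_measurable M) \<and>
     (AE \<omega> in M. X 0 \<omega> = x0) \<and>
     (\<forall>j. AE \<omega> in M.
        X (Suc j) \<omega> = X j \<omega> + ((1 - \<theta>) * \<tau>) *\<^sub>R b (X j \<omega>) + (\<theta> * \<tau>) *\<^sub>R b (X (Suc j) \<omega>)
          + \<sigma> (X j \<omega>) *v (W (real (Suc j) * \<tau>) \<omega> - W (real j * \<tau>) \<omega>))"

text \<open>
  In what follows a chain is given by the family \<open>X\<close> of all its versions \<open>X x0\<close> with deterministic
  initial state \<open>x0\<close>. The equation below is the defining property of the conditional probability
  \<open>P x A = \<P>(X\<^sub>n\<^sub>+\<^sub>1 \<in> A | X\<^sub>n = x)\<close>, the same for all times and all initial states. Its instance at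
  \<open>n = 0\<close> makes \<open>P x0\<close> the law of the first step from \<open>x0\<close>, so that \<open>P\<close> is unique, and not just
  up to null sets.
\<close>

definition transition_kernel ::
    "'w measure \<Rightarrow> ('a::topological_space \<Rightarrow> nat \<Rightarrow> 'w \<Rightarrow> 'a) \<Rightarrow> ('a \<Rightarrow> 'a measure) \<Rightarrow> bool" where
  "transition_kernel M X P \<longleftrightarrow>
     P \<in> borel \<rightarrow>\<^sub>M prob_algebra borel \<and>
     (\<forall>x0 n. \<forall>A\<in>sets borel. \<forall>B\<in>sets borel.
        measure M {\<omega> \<in> space M. X x0 n \<omega> \<in> B \<and> X x0 (Suc n) \<omega> \<in> A}
          = (LINT x:B|distr M borel (X x0 n). measure (P x) A))"

definition invariant_prob_measure :: "('a::topological_space \<Rightarrow> 'a measure) \<Rightarrow> 'a measure \<Rightarrow> bool" where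
  "invariant_prob_measure P \<mu> \<longleftrightarrow>
     prob_space \<mu> \<and> sets \<mu> = sets borel \<and>
     (\<forall>A\<in>sets borel. (LINT x|\<mu>. measure (P x) A) = measure \<mu> A)"

definition unique_invariant_prob_measure ::
    "'w measure \<Rightarrow> ('a::topological_space \<Rightarrow> nat \<Rightarrow> 'w \<Rightarrow> 'a) \<Rightarrow> 'a measure \<Rightarrow> bool" where
  "unique_invariant_prob_measure M X \<pi> \<longleftrightarrow>
     (\<exists>P. transition_kernel M X P \<and> invariant_prob_measure P \<pi> \<and>
          (\<forall>\<mu>. invariant_prob_measure P \<mu> \<longrightarrow> \<mu> = \<pi>))"

definition uniquely_ergodic ::
    "'w measure \<Rightarrow> ('a::topological_space \<Rightarrow> nat \<Rightarrow> 'w \<Rightarrow> 'a) \<Rightarrow> bool" where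
  "uniquely_ergodic M X \<longleftrightarrow> (\<exists>\<pi>. unique_invariant_prob_measure M X \<pi>)"

text \<open>
  The Bochner integral of a non-integrable function is \<open>0\<close>, so the existence of both expectations
  is part of the claim.
\<close>

definition geometrically_ergodic ::
    "'w measure \<Rightarrow> ('a::topological_space \<Rightarrow> nat \<Rightarrow> 'w \<Rightarrow> 'a) \<Rightarrow> 'a measure \<Rightarrow> ('a \<Rightarrow> real) \<Rightarrow> bool" where
  "geometrically_ergodic M X \<pi> V \<longleftrightarrow>
     (\<exists>r K. 0 < r \<and> r < 1 \<and> 0 < K \<and>
        (\<forall>\<phi>\<in>borel_measurable borel. (\<forall>x. \<bar>\<phi> x\<bar> \<le> V x) \<longrightarrow>
           integrable \<pi> \<phi> \<and>
           (\<forall>x0 n. integrable M (\<lambda>\<omega>. \<phi> (X x0 n \<omega>)) \<and>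
              \<bar>(LINT \<omega>|M. \<phi> (X x0 n \<omega>)) - (LINT y|\<pi>. \<phi> y)\<bar> \<le> K * r ^ n * V x0)))"

definition stm_lyapunov ::
    "(real ^ 'd \<Rightarrow> real ^ 'd) \<Rightarrow> (real ^ 'd \<Rightarrow> real ^ 'm ^ 'd) \<Rightarrow> real \<Rightarrow> real \<Rightarrow> real \<Rightarrow> real ^ 'd \<Rightarrow> real" where
  "stm_lyapunov b \<sigma> \<theta> \<tau> \<eta> x =
     (norm (x - ((1 - \<theta> + \<eta>) * \<tau>) *\<^sub>R b x))\<^sup>2 + (2 * \<theta> - 1 - \<eta>) * (norm (\<sigma> x))\<^sup>2 * \<tau> + 1"

end

theory Submission
  imports Defs
begin

text \<open>
  Write \<open>S x = x - \<theta> \<tau> b x\<close> and \<open>T x = x + (1 - \<theta>) \<tau> b x\<close>. The map \<open>S\<close> is strongly monotone, hence a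
  homeomorphism, and the transition kernel \<open>P x\<close> is the law of \<open>S\<^sup>-\<^sup>1 (T x + \<sigma> x w)\<close> with \<open>w\<close> a centred
  Gaussian vector of covariance \<open>\<tau> I\<close>. As \<open>\<sigma> x\<close> has a right inverse that is bounded for bounded
  \<open>x\<close>, the kernel dominates a multiple of one probability measure \<open>\<nu>\<close> uniformly on bounded sets \<open>C\<close>:
  \<open>P x \<ge> \<epsilon> \<nu>\<close> for \<open>x \<in> C\<close>. Dissipativity gives the drift \<open>P \<bar>S\<bar>\<^sup>2 \<le> \<bar>S\<bar>\<^sup>2 - c + D 1\<^sub>C\<close>, and, for
  \<open>\<theta> > 1/2\<close>, the geometric drift \<open>P V \<le> \<gamma> V + K\<close>.

  Existence and uniqueness of the invariant measure follow by regeneration. With the residual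
  kernel \<open>Q x = P x - \<epsilon> 1\<^sub>C(x) \<nu>\<close>, the measure \<open>\<Sum>n. \<nu> Q\<^sup>n\<close> is invariant, and it is finite by the drift.
  Any invariant probability measure \<open>\<mu>\<close> satisfies \<open>\<mu> = \<mu> Q\<^sup>n + \<epsilon> \<mu>(C) (\<Sum>k<n. \<nu> Q\<^sup>k)\<close>, where the first term tends
  to \<open>0\<close>. Geometric ergodicity is Harris' theorem in the form of Hairer and Mattingly: \<open>P\<close> contracts
  the oscillation of functions weighted by \<open>2 + \<beta> V x + \<beta> V y\<close> for a suitable \<open>\<beta> > 0\<close>.
\<close>

subsection \<open>Regeneration for minorized kernels\<close>

text \<open>Energy is measured through S because S of the new state is T x + \<sigma> x w, so its
  second moment is exactly |T x|^2 + \<tau> |\<sigma> x|^2. As T x - S x = \<tau> b x, |T x|^2 - |S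
  x|^2 = 2 \<tau> <b x, x> + (1 - 2 \<theta>) \<tau>^2 |b x|^2. Dissipativity controls the first
  term together with the noise, and \<theta> \<ge> 1/2 gives the last one its sign. The obstacle is
  that b may grow superlinearly: |S x|^2 contains |b x|^2, which a decrease by a multiple of |x|^2
  does not control. At \<theta> = 1/2 the term in |b x|^2 vanishes, so only a decrease by a constant
  is left. That makes expected cycles finite, which is all that regeneration asks for, but it gives
  no rate. For \<theta> > 1/2 the parameter \<lambda> > 0 in V recovers a negative multiple of |b
  x|^2, and |x|^2 + |b x|^2 + 1 dominates V up to a factor; this is the geometric drift.\<close>

lemma nn_integral_measure_sum:
  assumes sets: "sets L = sets N" "sets M = sets N"
    and sum: "\<And>A. A \<in> sets N \<Longrightarrow> emeasure N A = emeasure M A + a * emeasure L A"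
    and f: "f \<in> borel_measurable N"
  shows "(\<integral>\<^sup>+x. f x \<partial>N) = (\<integral>\<^sup>+x. f x \<partial>M) + a * (\<integral>\<^sup>+x. f x \<partial>L)"
  using f
proof (induction rule: borel_measurable_induct)
  case (cong f g)
  have "space M = space N" "space L = space N"
    using sets by (auto dest: sets_eq_imp_space_eq)
  then have "integral\<^sup>N N f = integral\<^sup>N N g" "integral\<^sup>N M f = integral\<^sup>N M g"
      "integral\<^sup>N L f = integral\<^sup>N L g"
    using cong(3) by (auto intro!: nn_integral_cong)
  with cong show ?case
    by simp
next
  case (set A)
  then show ?case
    by (simp add: sets sum)
next
  case (mult u c)
  note [measurable] = mult(2)
  have [measurable]: "u \<in> borel_measurable M" "u \<in> borel_measurable L"
    using mult(2) by (simp_all add: sets cong: measurable_cong_sets)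
  from mult show ?case
    by (simp add: nn_integral_cmult distrib_left mult.left_commute)
next
  case (add u v)
  note [measurable] = add(1,3)
  have [measurable]: "u \<in> borel_measurable M" "u \<in> borel_measurable L"
      "v \<in> borel_measurable M" "v \<in> borel_measurable L"
    using add(1,3) by (simp_all add: sets cong: measurable_cong_sets)
  from add show ?case
    by (simp add: nn_integral_add distrib_left algebra_simps)
next
  case (seq U)
  have [measurable]: "U i \<in> borel_measurable N" "U i \<in> borel_measurable M"
      "U i \<in> borel_measurable L" for i
    using seq(1)[of i] by (simp_all add: sets cong: measurable_cong_sets)
  have inc: "incseq (\<lambda>i. integral\<^sup>N M (U i))" "incseq (\<lambda>i. integral\<^sup>N L (U i))"
    using \<open>incseq U\<close> by (auto simp: incseq_def le_fun_def intro!: nn_integral_mono)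
  have "(\<integral>\<^sup>+x. (SUP i. U i) x \<partial>N) = (SUP i. integral\<^sup>N N (U i))"
    using \<open>incseq U\<close> by (simp add: nn_integral_monotone_convergence_SUP SUP_apply image_image)
  also have "\<dots> = (SUP i. integral\<^sup>N M (U i) + a * integral\<^sup>N L (U i))"
    by (simp add: seq.IH)
  also have "\<dots> = (SUP i. integral\<^sup>N M (U i)) + (SUP i. a * integral\<^sup>N L (U i))"
    using inc by (intro ennreal_SUP_add) (auto simp: incseq_def intro!: mult_left_mono)
  also have "(SUP i. a * integral\<^sup>N L (U i)) = a * (SUP i. integral\<^sup>N L (U i))"
    by (simp add: SUP_mult_left_ennreal)
  finally show ?case
    using \<open>incseq U\<close> by (simp add: nn_integral_monotone_convergence_SUP SUP_apply image_image)
qed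

locale minorized_kernel =
  fixes N :: "'a measure" and P :: "'a \<Rightarrow> 'a measure" and C :: "'a set"
    and \<epsilon> :: real and \<nu> :: "'a measure"
  assumes P_kernel: "P \<in> N \<rightarrow>\<^sub>M prob_algebra N"
    and C_sets[measurable]: "C \<in> sets N"
    and \<epsilon>_pos: "0 < \<epsilon>"
    and \<nu>_prob: "prob_space \<nu>" and sets_\<nu>[measurable_cong, simp]: "sets \<nu> = sets N"
    and minorization: "\<And>x A. x \<in> C \<Longrightarrow> A \<in> sets N \<Longrightarrow> ennreal \<epsilon> * emeasure \<nu> A \<le> emeasure (P x) A"
begin

lemma P_subprob[measurable]: "P \<in> N \<rightarrow>\<^sub>M subprob_algebra N"
  using P_kernel by (rule measurable_prob_algebraD)

lemma prob_space_P: "x \<in> space N \<Longrightarrow> prob_space (P x)"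
  and sets_P[simp]: "x \<in> space N \<Longrightarrow> sets (P x) = sets N"
  using measurable_space[OF P_kernel, of x] by (simp_all add: space_prob_algebra)

lemma space_P[simp]: "x \<in> space N \<Longrightarrow> space (P x) = space N"
  by (rule sets_eq_imp_space_eq) simp

lemma space_\<nu>[simp]: "space \<nu> = space N"
  by (rule sets_eq_imp_space_eq) simp

definition residual :: "'a \<Rightarrow> 'a measure" where
  "residual x = diff_measure (P x) (scale_measure (ennreal \<epsilon> * indicator C x) \<nu>)"

lemma sets_residual[simp]: "x \<in> space N \<Longrightarrow> sets (residual x) = sets N"
  by (simp add: residual_def)

lemma residual_le: 
  assumes x: "x \<in> space N" and A: "A \<in> sets N"
  shows "ennreal \<epsilon> * indicator C x * emeasure \<nu> A \<le> emeasure (P x) A"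
  using minorization[OF _ A, of x] by (auto simp: indicator_def)

lemma emeasure_residual:
  assumes x: "x \<in> space N" and A: "A \<in> sets N"
  shows "emeasure (residual x) A = emeasure (P x) A - ennreal \<epsilon> * indicator C x * emeasure \<nu> A"
proof -
  interpret p: prob_space "P x" by (rule prob_space_P[OF x])
  interpret n: prob_space \<nu> by (rule \<nu>_prob)
  have "finite_measure (scale_measure (ennreal \<epsilon> * indicator C x) \<nu>)"
    by (rule finite_measureI) (simp add: n.emeasure_space_1[simplified] ennreal_mult_eq_top_iff indicator_def)
  then show ?thesis
    unfolding residual_def using x A
    by (subst emeasure_diff_measure) (auto simp: residual_le p.finite_measure_axioms)
qed

lemma residual_kernel[measurable]: "residual \<in> N \<rightarrow>\<^sub>M subprob_algebra N"
proof (rule measurable_subprob_algebra)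
  fix x assume x: "x \<in> space N"
  interpret p: prob_space "P x" by (rule prob_space_P[OF x])
  show "subprob_space (residual x)"
  proof (rule subprob_spaceI)
    have "space (residual x) = space N"
      using x by (simp add: residual_def)
    then show "emeasure (residual x) (space (residual x)) \<le> 1" "space (residual x) \<noteq> {}"
      using x p.emeasure_space_1 by (auto simp: emeasure_residual)
  qed
next
  show "x \<in> space N \<Longrightarrow> sets (residual x) = sets N" for x by simp
next
  fix A assume A[measurable]: "A \<in> sets N"
  show "(\<lambda>x. emeasure (residual x) A) \<in> borel_measurable N"
    by (subst measurable_cong[OF emeasure_residual[OF _ A]]) measurable
qed

lemma nn_integral_P:
  assumes x: "x \<in> space N" and f: "f \<in> borel_measurable N"
  shows "(\<integral>\<^sup>+y. f y \<partial>P x) = (\<integral>\<^sup>+y. f y \<partial>residual x) + ennreal \<epsilon> * indicator C x * (\<integral>\<^sup>+y. f y \<partial>\<nu>)"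
proof (rule nn_integral_measure_sum)
  fix A assume "A \<in> sets (P x)"
  then show "emeasure (P x) A = emeasure (residual x) A + ennreal \<epsilon> * indicator C x * emeasure \<nu> A"
    using x residual_le[OF x, of A] by (simp add: emeasure_residual diff_add_cancel_ennreal)
qed (use x f in \<open>simp_all cong: measurable_cong_sets\<close>)

definition residual_op :: "('a \<Rightarrow> ennreal) \<Rightarrow> 'a \<Rightarrow> ennreal" where
  "residual_op h x = (\<integral>\<^sup>+y. h y \<partial>residual x)"

lemma residual_op_measurable[measurable]:
  "h \<in> borel_measurable N \<Longrightarrow> residual_op h \<in> borel_measurable N"
  unfolding residual_op_def
  by (rule measurable_compose[OF residual_kernel nn_integral_measurable_subprob_algebra])

lemma residual_op_funpow_measurable[measurable]:
  "h \<in> borel_measurable N \<Longrightarrow> (residual_op ^^ n) h \<in> borel_measurable N"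
  by (induction n) auto

lemma residual_op_mono:
  assumes "\<And>x. x \<in> space N \<Longrightarrow> f x \<le> g x" "x \<in> space N"
  shows "residual_op f x \<le> residual_op g x"
  unfolding residual_op_def using assms
  by (intro nn_integral_mono) (auto dest: sets_eq_imp_space_eq[OF sets_residual])

lemma residual_op_add:
  assumes "f \<in> borel_measurable N" "g \<in> borel_measurable N" "x \<in> space N"
  shows "residual_op (\<lambda>y. f y + g y) x = residual_op f x + residual_op g x"
  unfolding residual_op_def using assms
  by (intro nn_integral_add) (auto cong: measurable_cong_sets)

text \<open>A telescoping supermartingale bound. The iterate of \<open>U\<close> stays on the left
  because nothing can be subtracted in \<open>ennreal\<close>; dropping it bounds the total cost of
  an excursion from \<open>x\<close> by \<open>U x\<close>.\<close>

lemma residual_op_funpow_drift: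
  assumes [measurable]: "U \<in> borel_measurable N" "g \<in> borel_measurable N"
    and drift: "\<And>x. x \<in> space N \<Longrightarrow> residual_op U x + g x \<le> U x"
  shows "x \<in> space N \<Longrightarrow> (residual_op ^^ n) U x + (\<Sum>k<n. (residual_op ^^ k) g x) \<le> U x"
proof (induction n arbitrary: x)
  case (Suc n)
  have sum: "(\<lambda>y. \<Sum>k<n. (residual_op ^^ k) g y) \<in> borel_measurable N"
    by measurable
  have sum': "residual_op (\<lambda>y. \<Sum>k<n. (residual_op ^^ k) g y) x = (\<Sum>k<n. (residual_op ^^ Suc k) g x)"
    unfolding residual_op_def using \<open>x \<in> space N\<close>
    by (subst nn_integral_sum) (auto cong: measurable_cong_sets simp: residual_op_def[symmetric])
  have "(residual_op ^^ Suc n) U x + (\<Sum>k<Suc n. (residual_op ^^ k) g x)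
      = residual_op ((residual_op ^^ n) U) x + residual_op (\<lambda>y. \<Sum>k<n. (residual_op ^^ k) g y) x + g x"
    unfolding sum' by (subst sum.lessThan_Suc_shift) (simp add: ac_simps)
  also have "\<dots> = residual_op (\<lambda>y. (residual_op ^^ n) U y + (\<Sum>k<n. (residual_op ^^ k) g y)) x + g x"
    by (subst residual_op_add) (use Suc.prems sum in auto)
  also have "\<dots> \<le> residual_op U x + g x"
    by (intro add_right_mono residual_op_mono Suc)
  also have "\<dots> \<le> U x"
    using Suc.prems by (rule drift)
  finally show ?case .
qed simp

section \<open>Excursions between regenerations\<close>

primrec excursion :: "nat \<Rightarrow> 'a measure" where
  "excursion 0 = \<nu>"
| "excursion (Suc n) = excursion n \<bind> residual"

lemma excursion_subprob: "excursion n \<in> space (subprob_algebra N)"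
proof (induction n)
  case 0
  then show ?case 
    using \<nu>_prob by (simp add: space_subprob_algebra prob_space_imp_subprob_space)
next
  case (Suc n)
  have "(\<lambda>_::unit. excursion n \<bind> residual) \<in> count_space UNIV \<rightarrow>\<^sub>M subprob_algebra N"
    using Suc by (intro measurable_bind2[OF _ residual_kernel]) simp
  then show ?case
    by (auto dest: measurable_space)
qed

lemma sets_excursion[measurable_cong, simp]: "sets (excursion n) = sets N"
  using excursion_subprob[of n] by (simp add: space_subprob_algebra)

lemma nn_integral_excursion:
  "h \<in> borel_measurable N \<Longrightarrow> (\<integral>\<^sup>+x. h x \<partial>excursion n) = (\<integral>\<^sup>+x. (residual_op ^^ n) h x \<partial>\<nu>)"
proof (induction n arbitrary: h)
  case (Suc n)
  have "(\<integral>\<^sup>+x. h x \<partial>excursion (Suc n)) = (\<integral>\<^sup>+x. residual_op h x \<partial>excursion n)"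
    unfolding residual_op_def excursion.simps
    by (rule nn_integral_bind[where B=N])
       (use Suc.prems residual_kernel in \<open>auto cong: measurable_cong_sets\<close>)
  with Suc show ?case
    by (simp add: funpow_Suc_right del: funpow.simps)
qed simp

text \<open>\<open>excursion n\<close> is the law n steps after a regeneration on the event that no
  other one has occurred, so this is the expected time spent in a set during one cycle. Binding the
  counting measure with the excursions encodes the infinite sum of measures.\<close>

definition occupation :: "'a measure" where
  "occupation = count_space UNIV \<bind> excursion"

lemma excursion_kernel: "excursion \<in> count_space UNIV \<rightarrow>\<^sub>M subprob_algebra N"
  using excursion_subprob by simp

lemma sets_occupation[measurable_cong, simp]: "sets occupation = sets N"
  unfolding occupation_def by (rule sets_bind) auto

lemma nn_integral_occupation:
  "h \<in> borel_measurable N \<Longrightarrow> (\<integral>\<^sup>+x. h x \<partial>occupation) = (\<Sum>n. \<integral>\<^sup>+x. h x \<partial>excursion n)"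
  unfolding occupation_def
  by (subst nn_integral_bind[OF _ excursion_kernel]) (simp_all add: nn_integral_count_space_nat)

text \<open>The telescoped bound, integrated over the restart law \<open>\<nu>\<close>: the mean of
  \<open>U\<close> bounds the expected total cost \<open>g\<close> of one cycle.\<close>

lemma nn_integral_occupation_le:
  assumes [measurable]: "U \<in> borel_measurable N" "g \<in> borel_measurable N"
    and drift: "\<And>x. x \<in> space N \<Longrightarrow> residual_op U x + g x \<le> U x"
  shows "(\<integral>\<^sup>+x. g x \<partial>occupation) \<le> (\<integral>\<^sup>+x. U x \<partial>\<nu>)"
proof -
  have "(\<Sum>k<n. \<integral>\<^sup>+x. g x \<partial>excursion k) \<le> (\<integral>\<^sup>+x. U x \<partial>\<nu>)" for n
  proof -
    have "(\<Sum>k<n. \<integral>\<^sup>+x. g x \<partial>excursion k) = (\<integral>\<^sup>+x. (\<Sum>k<n. (residual_op ^^ k) g x) \<partial>\<nu>)"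
      by (subst nn_integral_sum) (auto simp: nn_integral_excursion cong: measurable_cong_sets)
    also have "\<dots> \<le> (\<integral>\<^sup>+x. U x \<partial>\<nu>)"
    proof (rule nn_integral_mono)
      fix x assume "x \<in> space \<nu>"
      then have "(residual_op ^^ n) U x + (\<Sum>k<n. (residual_op ^^ k) g x) \<le> U x"
        by (intro residual_op_funpow_drift assms) auto
      then show "(\<Sum>k<n. (residual_op ^^ k) g x) \<le> U x"
        by (rule order_trans[rotated]) simp
    qed
    finally show ?thesis .
  qed
  then show ?thesis
    by (subst nn_integral_occupation) (auto intro!: suminf_le_const)
qed

text \<open>A step from \<open>occupation\<close> either continues an excursion, which reproduces
  all terms but \<open>excursion 0\<close>, or regenerates with total weight \<epsilon> times the
  occupation of \<open>C\<close>. The missing \<open>\<nu>\<close> is added on the left to avoid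
  subtraction in \<open>ennreal\<close>. Invariance thus reduces to that weight being 1.\<close>

lemma occupation_P:
  assumes [measurable]: "A \<in> sets N"
  shows "(\<integral>\<^sup>+x. emeasure (P x) A \<partial>occupation) + emeasure \<nu> A
    = emeasure occupation A + ennreal \<epsilon> * emeasure occupation C * emeasure \<nu> A"
proof -
  have [simp]: "space occupation = space N"
    by (rule sets_eq_imp_space_eq) simp
  have "(\<integral>\<^sup>+x. emeasure (P x) A \<partial>occupation)
      = (\<integral>\<^sup>+x. residual_op (indicator A) x + ennreal \<epsilon> * emeasure \<nu> A * indicator C x \<partial>occupation)"
  proof (rule nn_integral_cong)
    fix x assume "x \<in> space occupation"
    then show "emeasure (P x) A = residual_op (indicator A) x + ennreal \<epsilon> * emeasure \<nu> A * indicator C x"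
      using nn_integral_P[of x "indicator A"] by (simp add: residual_op_def ac_simps)
  qed
  also have "\<dots> = (\<integral>\<^sup>+x. residual_op (indicator A) x \<partial>occupation)
      + ennreal \<epsilon> * emeasure \<nu> A * emeasure occupation C"
    by (subst nn_integral_add) (auto simp: nn_integral_cmult_indicator)
  also have "(\<integral>\<^sup>+x. residual_op (indicator A) x \<partial>occupation) = (\<Sum>n. emeasure (excursion (Suc n)) A)"
  proof -
    have "(\<integral>\<^sup>+x. residual_op (indicator A) x \<partial>excursion n) = emeasure (excursion (Suc n)) A" for n
      unfolding residual_op_def excursion.simps
      by (subst nn_integral_bind[symmetric, where B=N])
         (use residual_kernel sets_excursion[of "Suc n"] in \<open>auto cong: measurable_cong_sets\<close>)
    then show ?thesis
      by (simp add: nn_integral_occupation del: excursion.simps)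
  qed
  finally have *: "(\<integral>\<^sup>+x. emeasure (P x) A \<partial>occupation)
    = (\<Sum>n. emeasure (excursion (Suc n)) A) + ennreal \<epsilon> * emeasure \<nu> A * emeasure occupation C" .
  have "emeasure occupation A = (\<Sum>n. emeasure (excursion n) A)"
    using nn_integral_occupation[of "indicator A"] by simp
  also have "\<dots> = (\<Sum>n. emeasure (excursion (Suc n)) A) + emeasure \<nu> A"
    by (subst suminf_offset[where i=1]) (simp_all add: add.commute)
  finally show ?thesis
    unfolding * by (simp add: ac_simps)
qed

text \<open>Stationary mass is sorted by the time since the last regeneration: one within the last n
  steps contributes to the sum, none at all to the remainder.\<close>

lemma invariant_eq_occupation:
  assumes [measurable_cong, simp]: "sets \<mu> = sets N"
    and inv: "\<And>h. h \<in> borel_measurable N \<Longrightarrow> (\<integral>\<^sup>+x. \<integral>\<^sup>+y. h y \<partial>P x \<partial>\<mu>) = (\<integral>\<^sup>+x. h x \<partial>\<mu>)"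
    and [measurable]: "h \<in> borel_measurable N"
  shows "(\<integral>\<^sup>+x. h x \<partial>\<mu>) = (\<integral>\<^sup>+x. (residual_op ^^ n) h x \<partial>\<mu>)
    + ennreal \<epsilon> * emeasure \<mu> C * (\<Sum>k<n. \<integral>\<^sup>+x. h x \<partial>excursion k)"
proof (induction n)
  case (Suc n)
  have [simp]: "space \<mu> = space N"
    by (rule sets_eq_imp_space_eq) simp
  \<comment> \<open>Invariance is applied to the n-th iterate instead of \<open>h\<close>, so that
    the regeneration term is the next summand.\<close>
  define f where "f = (residual_op ^^ n) h"
  have [measurable]: "f \<in> borel_measurable N"
    unfolding f_def by measurable
  have "(\<integral>\<^sup>+x. f x \<partial>\<mu>) = (\<integral>\<^sup>+x. \<integral>\<^sup>+y. f y \<partial>P x \<partial>\<mu>)"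
    by (simp add: inv)
  also have "\<dots> = (\<integral>\<^sup>+x. residual_op f x + ennreal \<epsilon> * (\<integral>\<^sup>+y. f y \<partial>\<nu>) * indicator C x \<partial>\<mu>)"
    by (intro nn_integral_cong) (simp add: nn_integral_P residual_op_def ac_simps)
  also have "\<dots> = (\<integral>\<^sup>+x. residual_op f x \<partial>\<mu>) + ennreal \<epsilon> * (\<integral>\<^sup>+y. f y \<partial>\<nu>) * emeasure \<mu> C"
    by (subst nn_integral_add) (auto simp: nn_integral_cmult_indicator)
  also have "(\<integral>\<^sup>+y. f y \<partial>\<nu>) = (\<integral>\<^sup>+y. h y \<partial>excursion n)"
    by (simp add: f_def nn_integral_excursion)
  finally show ?case
    using Suc by (simp add: f_def ac_simps distrib_left)
qed simp


lemma nn_integral_invariant: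
  assumes [measurable_cong, simp]: "sets \<mu> = sets N" and "prob_space \<mu>"
    and inv: "\<And>A. A \<in> sets N \<Longrightarrow> (\<integral>\<^sup>+x. emeasure (P x) A \<partial>\<mu>) = emeasure \<mu> A"
    and h[measurable]: "h \<in> borel_measurable N"
  shows "(\<integral>\<^sup>+x. \<integral>\<^sup>+y. h y \<partial>P x \<partial>\<mu>) = (\<integral>\<^sup>+x. h x \<partial>\<mu>)"
proof -
  interpret m: prob_space \<mu> by fact
  have P: "P \<in> \<mu> \<rightarrow>\<^sub>M subprob_algebra N" by measurable
  have "\<mu> \<bind> P = \<mu>"
  proof (rule measure_eqI)
    show sets_eq: "sets (\<mu> \<bind> P) = sets \<mu>"
      by (simp add: sets_bind[OF sets_kernel[OF P] m.not_empty])
    fix A assume "A \<in> sets (\<mu> \<bind> P)"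
    then have "A \<in> sets N" by (simp add: sets_eq)
    then show "emeasure (\<mu> \<bind> P) A = emeasure \<mu> A"
      by (subst emeasure_bind[OF m.not_empty P]) (simp_all add: inv)
  qed
  with nn_integral_bind[OF h P] show ?thesis
    by simp
qed

text \<open>Adding a constant to the drift function makes the drift hold for the residual kernel on
  all of the space: on \<open>C\<close> the residual kernel loses the mass \<open>\<epsilon>\<close>.\<close>
lemma residual_drift:
  assumes [measurable]: "V \<in> borel_measurable N" and D: "0 \<le> D" and x: "x \<in> space N"
    and drift: "(\<integral>\<^sup>+y. V y \<partial>P x) + g x \<le> V x + ennreal D * indicator C x"
  shows "residual_op (\<lambda>y. V y + ennreal (D / \<epsilon>)) x + g x \<le> V x + ennreal (D / \<epsilon>)"
proof -
  interpret p: prob_space "P x" by (rule prob_space_P[OF x])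
  interpret n: prob_space \<nu> by (rule \<nu>_prob)
  let ?U = "\<lambda>y. V y + ennreal (D / \<epsilon>)"
  have VP: "V \<in> borel_measurable (P x)"
    using x by (simp cong: measurable_cong_sets)
  have "ennreal D * indicator C x \<le> ennreal \<epsilon> * indicator C x * (\<integral>\<^sup>+y. ?U y \<partial>\<nu>)"
  proof -
    have "ennreal (D / \<epsilon>) \<le> (\<integral>\<^sup>+y. ?U y \<partial>\<nu>)"
      using n.emeasure_space_1 by (subst nn_integral_add) (simp_all)
    then have "ennreal \<epsilon> * ennreal (D / \<epsilon>) \<le> ennreal \<epsilon> * (\<integral>\<^sup>+y. ?U y \<partial>\<nu>)"
      by (rule mult_left_mono) simp
    also have "ennreal \<epsilon> * ennreal (D / \<epsilon>) = ennreal D"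
      using \<epsilon>_pos D by (simp add: ennreal_mult[symmetric])
    finally show ?thesis
      by (simp add: indicator_def)
  qed
  then have "residual_op ?U x + g x + ennreal D * indicator C x
      \<le> residual_op ?U x + g x + ennreal \<epsilon> * indicator C x * (\<integral>\<^sup>+y. ?U y \<partial>\<nu>)"
    by (rule add_left_mono)
  also have "\<dots> = (\<integral>\<^sup>+y. ?U y \<partial>P x) + g x"
    unfolding residual_op_def by (subst nn_integral_P[OF x]) (simp_all add: ac_simps)
  also have "\<dots> = (\<integral>\<^sup>+y. V y \<partial>P x) + g x + ennreal (D / \<epsilon>)"
    using VP p.emeasure_space_1 x by (subst nn_integral_add) (simp_all add: ac_simps)
  also have "\<dots> \<le> V x + ennreal (D / \<epsilon>) + ennreal D * indicator C x"
    using add_right_mono[OF drift, of "ennreal (D / \<epsilon>)"] by (simp add: ac_simps)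
  finally show ?thesis
    by (cases "x \<in> C")
       (simp_all add: ennreal_add_left_cancel_le add.commute[of _ "ennreal D"])
qed

text \<open>The cost \<open>g\<close> is kept apart from its lower bound \<open>c\<close> because
  its integral is part of the conclusion: a constant cost suffices for existence and uniqueness, a
  cost proportional to a Lyapunov function also yields the integrability of that function.\<close>

theorem drift_unique_invariant:
  assumes V[measurable]: "V \<in> borel_measurable N" and g[measurable]: "g \<in> borel_measurable N"
    and drift: "\<And>x. x \<in> space N \<Longrightarrow> (\<integral>\<^sup>+y. V y \<partial>P x) + g x \<le> V x + ennreal D * indicator C x"
    and D: "0 \<le> D" and c: "0 < c" and g_ge: "\<And>x. x \<in> space N \<Longrightarrow> ennreal c \<le> g x"
    and V_fin: "\<And>x. x \<in> space N \<Longrightarrow> V x < \<infinity>" and C: "C \<noteq> {}"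
  shows "\<exists>\<pi>. prob_space \<pi> \<and> sets \<pi> = sets N \<and>
    (\<forall>A\<in>sets N. (\<integral>\<^sup>+x. emeasure (P x) A \<partial>\<pi>) = emeasure \<pi> A) \<and> (\<integral>\<^sup>+x. g x \<partial>\<pi>) < \<infinity> \<and>
    (\<forall>\<mu>. prob_space \<mu> \<and> sets \<mu> = sets N \<and>
      (\<forall>A\<in>sets N. (\<integral>\<^sup>+x. emeasure (P x) A \<partial>\<mu>) = emeasure \<mu> A) \<longrightarrow> \<mu> = \<pi>)"
proof -
  interpret n: prob_space \<nu> by (rule \<nu>_prob)
  obtain z where z: "z \<in> C" "z \<in> space N"
    using C sets.sets_into_space[OF C_sets] by auto
  \<comment> \<open>Nonemptiness of \<open>C\<close> enters here: minorization at a single point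
    \<open>z\<close> bounds the \<open>\<nu>\<close>-integral of \<open>V\<close> by the drift bound
    at \<open>z\<close>.\<close>
  have "ennreal \<epsilon> * (\<integral>\<^sup>+x. V x \<partial>\<nu>) \<le> (\<integral>\<^sup>+y. V y \<partial>P z)"
    using z by (subst nn_integral_P) auto
  also have "\<dots> \<le> (\<integral>\<^sup>+y. V y \<partial>P z) + g z"
    by simp
  also have "\<dots> \<le> V z + ennreal D"
    using drift[OF z(2)] z(1) by simp
  also have "\<dots> < \<infinity>"
    using V_fin[OF z(2)] by simp
  finally have \<nu>V: "(\<integral>\<^sup>+x. V x \<partial>\<nu>) < \<infinity>"
    using \<epsilon>_pos by (auto simp: ennreal_mult_less_top)
  define U where "U x = V x + ennreal (D / \<epsilon>)" for x
  have U[measurable]: "U \<in> borel_measurable N" unfolding U_def by measurable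
  have U_drift: "residual_op U x + g x \<le> U x" if "x \<in> space N" for x
    unfolding U_def by (rule residual_drift[OF V D that]) (rule drift[OF that])
  have "(\<integral>\<^sup>+x. U x \<partial>\<nu>) = (\<integral>\<^sup>+x. V x \<partial>\<nu>) + ennreal (D / \<epsilon>)"
    unfolding U_def using n.emeasure_space_1 by (subst nn_integral_add) simp_all
  then have U_fin: "(\<integral>\<^sup>+x. U x \<partial>\<nu>) < \<infinity>"
    using \<nu>V by simp
  have g_fin: "(\<integral>\<^sup>+x. g x \<partial>occupation) < \<infinity>"
    using nn_integral_occupation_le[OF U g U_drift] U_fin by (rule le_less_trans)
  have [simp]: "space occupation = space N"
    by (rule sets_eq_imp_space_eq) simp
  define m where "m = emeasure occupation (space N)"
  have "ennreal c * m = (\<integral>\<^sup>+x. ennreal c \<partial>occupation)"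
    by (simp add: m_def)
  also have "\<dots> \<le> (\<integral>\<^sup>+x. g x \<partial>occupation)"
    by (intro nn_integral_mono) (simp add: g_ge)
  finally have m_fin: "m < \<infinity>"
    using g_fin c by (auto simp: ennreal_mult_less_top top_unique less_top[symmetric] ennreal_mult_eq_top_iff)
  \<comment> \<open>Mass balance: \<open>occupation_P\<close> on the whole space, with the finite
    mass \<open>m\<close> cancelled, says that the expected number of regenerations per cycle is
    1.\<close>
  have total: "ennreal \<epsilon> * emeasure occupation C = 1"
  proof -
    have "(\<integral>\<^sup>+x. emeasure (P x) (space N) \<partial>occupation) = m"
    proof -
      have "emeasure (P x) (space N) = 1" if "x \<in> space N" for x
        using prob_space.emeasure_space_1[OF prob_space_P[OF that]] that by simp
      then show ?thesis
        by (simp add: m_def cong: nn_integral_cong_simp)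
    qed
    with occupation_P[of "space N"] have "m + 1 = m + ennreal \<epsilon> * emeasure occupation C"
      using n.emeasure_space_1 by (simp add: m_def)
    then show ?thesis
      using m_fin by (auto simp: ennreal_add_left_cancel)
  qed
  have occ_inv: "(\<integral>\<^sup>+x. emeasure (P x) A \<partial>occupation) = emeasure occupation A" if "A \<in> sets N" for A
  proof -
    have "emeasure \<nu> A + (\<integral>\<^sup>+x. emeasure (P x) A \<partial>occupation) = emeasure \<nu> A + emeasure occupation A"
      using occupation_P[OF that] total by (simp add: ac_simps)
    moreover have "emeasure \<nu> A \<noteq> \<infinity>" by simp
    ultimately show ?thesis
      by (simp only: ennreal_add_left_cancel) simp
  qed
  \<comment> \<open>The first excursion term alone has mass 1, so the normalizing factor
    \<open>inverse m\<close> is finite.\<close>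
  have "1 \<le> m"
  proof -
    have "emeasure (excursion 0) (space N) \<le> (\<Sum>n. emeasure (excursion n) (space N))"
      using sum_le_suminf[of "\<lambda>n. emeasure (excursion n) (space N)" "{0}"] by simp
    also have "\<dots> = m"
      using nn_integral_occupation[of "indicator (space N)"] by (simp add: m_def)
    finally show ?thesis
      using n.emeasure_space_1 by simp
  qed
  then have "m \<noteq> 0" by auto
  then have r: "inverse m * m = 1"
    using m_fin by (subst mult.commute) (auto simp: ennreal_divide_self divide_ennreal_def[symmetric])
  have r_fin: "inverse m < \<infinity>"
    using \<open>1 \<le> m\<close> by (auto simp: less_top[symmetric])
  define \<pi> where "\<pi> = scale_measure (inverse m) occupation"
  have sets_\<pi>: "sets \<pi> = sets N"
    by (simp add: \<pi>_def)
  then have space_\<pi>: "space \<pi> = space N"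
    by (rule sets_eq_imp_space_eq)
  have nn_\<pi>: "(\<integral>\<^sup>+x. h x \<partial>\<pi>) = inverse m * (\<integral>\<^sup>+x. h x \<partial>occupation)"
    if "h \<in> borel_measurable N" for h
    unfolding \<pi>_def using that by (intro nn_integral_scale_measure) simp
  show ?thesis
  proof (intro exI[of _ \<pi>] conjI ballI allI impI)
    show "prob_space \<pi>"
      using r by (intro prob_spaceI) (simp add: space_\<pi>, simp add: \<pi>_def m_def)
    show "sets \<pi> = sets N" by fact
    show "(\<integral>\<^sup>+x. emeasure (P x) A \<partial>\<pi>) = emeasure \<pi> A" if [measurable]: "A \<in> sets N" for A
      by (subst nn_\<pi>) (simp_all add: occ_inv \<pi>_def)
    show "(\<integral>\<^sup>+x. g x \<partial>\<pi>) < \<infinity>"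
      using g_fin r_fin by (simp add: nn_\<pi> ennreal_mult_less_top)
  next
    fix \<mu> assume "prob_space \<mu> \<and> sets \<mu> = sets N \<and>
      (\<forall>A\<in>sets N. (\<integral>\<^sup>+x. emeasure (P x) A \<partial>\<mu>) = emeasure \<mu> A)"
    then have \<mu>: "prob_space \<mu>" "sets \<mu> = sets N"
      and inv: "\<And>A. A \<in> sets N \<Longrightarrow> (\<integral>\<^sup>+x. emeasure (P x) A \<partial>\<mu>) = emeasure \<mu> A"
      by auto
    interpret mu: prob_space \<mu> by fact
    note [measurable_cong, simp] = \<mu>(2)
    have [simp]: "space \<mu> = space N"
      by (rule sets_eq_imp_space_eq) simp
    have \<mu>C_fin: "emeasure \<mu> C < top"
      using mu.emeasure_finite[of C] by (simp add: less_top[symmetric])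
    have key: "emeasure \<mu> A = ennreal \<epsilon> * emeasure \<mu> C * emeasure occupation A"
      if A[measurable]: "A \<in> sets N" for A
    proof -
      \<comment> \<open>Scaling the indicator by \<open>c\<close> puts \<open>h\<close> below
        \<open>g\<close>. The drift then bounds the series of iterates of \<open>h\<close> pointwise
        by the finite \<open>U\<close>, so the iterates tend to 0; they are also dominated by the
        constant \<open>c\<close>.\<close>
      define h where "h x = ennreal c * indicator A x" for x
      have h[measurable]: "h \<in> borel_measurable N" unfolding h_def by measurable
      have h_le: "(residual_op ^^ n) h x \<le> ennreal c" if "x \<in> space N" for n x
        using that
      proof (induction n arbitrary: x)
        case (Suc n)
        interpret r: subprob_space "residual x"
          using Suc.prems by (rule subprob_space_kernel[OF residual_kernel])
        have "space (residual x) = space N"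
          using Suc.prems by (intro sets_eq_imp_space_eq) simp
        with Suc.IH have "residual_op ((residual_op ^^ n) h) x \<le> ennreal c"
          unfolding residual_op_def by (intro r.nn_integral_le_const) auto
        then show ?case by simp
      qed (simp add: h_def indicator_def)
      have lim0: "(\<lambda>n. (residual_op ^^ n) h x) \<longlonglongrightarrow> 0" if x: "x \<in> space N" for x
      proof -
        define a where "a n = enn2real ((residual_op ^^ n) h x)" for n
        have a: "(residual_op ^^ n) h x = ennreal (a n)" for n
          unfolding a_def by (rule ennreal_enn2real[symmetric])
            (rule le_less_trans[OF h_le[OF x]], simp)
        have "(\<Sum>k<n. ennreal (a k)) \<le> U x" for n
        proof -
          have "residual_op U y + h y \<le> U y" if "y \<in> space N" for y
          proof -
            have "residual_op U y + h y \<le> residual_op U y + g y"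
              using g_ge[OF that] by (intro add_left_mono) (auto simp: h_def indicator_def)
            with U_drift[OF that] show ?thesis by (rule order_trans[rotated])
          qed
          then have "(residual_op ^^ n) U x + (\<Sum>k<n. (residual_op ^^ k) h x) \<le> U x"
            by (rule residual_op_funpow_drift[OF U h _ x])
          then show ?thesis
            unfolding a by (rule order_trans[rotated]) simp
        qed
        then have "(\<Sum>k. ennreal (a k)) \<le> U x"
          by (intro suminf_le_const) auto
        also have "U x < \<infinity>"
          using V_fin[OF x] by (simp add: U_def)
        finally have "summable a"
          by (intro summable_suminf_not_top) (auto simp: a_def)
        then have "a \<longlonglongrightarrow> 0" by (rule summable_LIMSEQ_zero)
        then show ?thesis
          unfolding a by (auto dest: tendsto_ennrealI)
      qed
      have lim1: "(\<lambda>n. \<integral>\<^sup>+x. (residual_op ^^ n) h x \<partial>\<mu>) \<longlonglongrightarrow> (\<integral>\<^sup>+x. 0 \<partial>\<mu>)"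
        by (rule nn_integral_dominated_convergence[where w="\<lambda>_. ennreal c"])
           (auto simp: h_le lim0 mu.emeasure_space_1[simplified] ennreal_mult_less_top)
      have lim2: "(\<lambda>n. \<Sum>k<n. \<integral>\<^sup>+x. h x \<partial>excursion k) \<longlonglongrightarrow> (\<integral>\<^sup>+x. h x \<partial>occupation)"
        unfolding nn_integral_occupation[OF h] by (rule summable_LIMSEQ) simp
      have "(\<lambda>n. (\<integral>\<^sup>+x. (residual_op ^^ n) h x \<partial>\<mu>)
            + ennreal \<epsilon> * emeasure \<mu> C * (\<Sum>k<n. \<integral>\<^sup>+x. h x \<partial>excursion k))
          \<longlonglongrightarrow> (\<integral>\<^sup>+x. 0 \<partial>\<mu>) + ennreal \<epsilon> * emeasure \<mu> C * (\<integral>\<^sup>+x. h x \<partial>occupation)"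
        by (intro tendsto_add lim1 ennreal_tendsto_cmult lim2)
           (use \<mu>C_fin in \<open>simp add: ennreal_mult_less_top\<close>)
      then have "(\<integral>\<^sup>+x. h x \<partial>\<mu>) = ennreal \<epsilon> * emeasure \<mu> C * (\<integral>\<^sup>+x. h x \<partial>occupation)"
        by (simp add: invariant_eq_occupation[OF \<mu>(2) nn_integral_invariant[OF \<mu>(2,1) inv] h, symmetric]
            LIMSEQ_const_iff)
      then have "ennreal c * emeasure \<mu> A
          = ennreal c * (ennreal \<epsilon> * emeasure \<mu> C * emeasure occupation A)"
        by (simp add: h_def nn_integral_cmult ac_simps)
      then show ?thesis
        using c by (simp add: ennreal_mult_cancel_left)
    qed
    \<comment> \<open>The whole space fixes the unknown factor in \<open>key\<close> as the same
      normalization that defines \<open>\<pi>\<close>.\<close>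
    have one: "ennreal \<epsilon> * emeasure \<mu> C * m = 1"
      using key[of "space N"] mu.emeasure_space_1 by (simp add: m_def)
    have "inverse m = (ennreal \<epsilon> * emeasure \<mu> C * m) * inverse m"
      unfolding one by simp
    also have "\<dots> = ennreal \<epsilon> * emeasure \<mu> C * (inverse m * m)"
      by (simp only: ac_simps)
    also have "\<dots> = ennreal \<epsilon> * emeasure \<mu> C"
      unfolding r by simp
    finally have inv_m: "inverse m = ennreal \<epsilon> * emeasure \<mu> C" .
    show "\<mu> = \<pi>"
    proof (rule measure_eqI)
      fix A assume "A \<in> sets \<mu>"
      then show "emeasure \<mu> A = emeasure \<pi> A"
        unfolding \<pi>_def inv_m emeasure_scale_measure by (intro key) simp
    qed (simp add: sets_\<pi>)
  qed
qed

end

subsection \<open>Contraction in weighted oscillation\<close>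

text \<open>Keeping two measures covers both stationarity, where they coincide, and the step between
  successive laws of a chain. Integrability under \<open>K x\<close> is required at every point,
  since the inner Bochner integral would otherwise silently be 0.\<close>

lemma integral_kernel_nonneg:
  fixes f :: "'a \<Rightarrow> real"
  assumes K: "K \<in> N \<rightarrow>\<^sub>M subprob_algebra N" and sets: "sets \<mu> = sets N" "sets \<mu>' = sets N"
    and step: "\<And>h. h \<in> borel_measurable N \<Longrightarrow> (\<integral>\<^sup>+x. h x \<partial>\<mu>') = (\<integral>\<^sup>+x. \<integral>\<^sup>+y. h y \<partial>K x \<partial>\<mu>)"
    and f[measurable]: "f \<in> borel_measurable N" "integrable \<mu>' f" "\<And>x. 0 \<le> f x"
    and fK: "\<And>x. x \<in> space N \<Longrightarrow> integrable (K x) f"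
  shows "integrable \<mu> (\<lambda>x. \<integral>y. f y \<partial>K x) \<and> (\<integral>y. f y \<partial>\<mu>') = (\<integral>x. \<integral>y. f y \<partial>K x \<partial>\<mu>)"
proof -
  have [simp]: "space \<mu> = space N"
    using sets(1) by (rule sets_eq_imp_space_eq)
  have meas: "(\<lambda>x. \<integral>y. f y \<partial>K x) \<in> borel_measurable \<mu>"
    using measurable_compose[OF K integral_measurable_subprob_algebra[OF f(1)]] sets
    by (simp cong: measurable_cong_sets)
  have nonneg: "0 \<le> (\<integral>y. f y \<partial>K x)" for x
    by (simp add: f)
  have "ennreal (\<integral>y. f y \<partial>\<mu>') = (\<integral>\<^sup>+x. \<integral>\<^sup>+y. ennreal (f y) \<partial>K x \<partial>\<mu>)"
    by (subst nn_integral_eq_integral[symmetric]) (simp_all add: f step)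
  also have "\<dots> = (\<integral>\<^sup>+x. ennreal (\<integral>y. f y \<partial>K x) \<partial>\<mu>)"
    by (intro nn_integral_cong nn_integral_eq_integral) (simp_all add: fK f)
  finally have "(\<integral>\<^sup>+x. ennreal (\<integral>y. f y \<partial>K x) \<partial>\<mu>) = ennreal (\<integral>y. f y \<partial>\<mu>')" ..
  then have "has_bochner_integral \<mu> (\<lambda>x. \<integral>y. f y \<partial>K x) (\<integral>y. f y \<partial>\<mu>')"
    by (intro has_bochner_integral_nn_integral meas) (simp_all add: f)
  then show ?thesis
    by (simp add: has_bochner_integral_iff)
qed

lemma integral_kernel:
  fixes f :: "'a \<Rightarrow> real"
  assumes K: "K \<in> N \<rightarrow>\<^sub>M subprob_algebra N" and sets: "sets \<mu> = sets N" "sets \<mu>' = sets N"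
    and step: "\<And>h. h \<in> borel_measurable N \<Longrightarrow> (\<integral>\<^sup>+x. h x \<partial>\<mu>') = (\<integral>\<^sup>+x. \<integral>\<^sup>+y. h y \<partial>K x \<partial>\<mu>)"
    and f[measurable]: "f \<in> borel_measurable N" "integrable \<mu>' f"
    and fK: "\<And>x. x \<in> space N \<Longrightarrow> integrable (K x) f"
  shows "(\<integral>y. f y \<partial>\<mu>') = (\<integral>x. \<integral>y. f y \<partial>K x \<partial>\<mu>)"
proof -
  define p where "p x = max 0 (f x)" for x
  define q where "q x = max 0 (- f x)" for x
  have f_eq: "f = (\<lambda>x. p x - q x)"
    by (auto simp: p_def q_def fun_eq_iff)
  have int: "integrable \<mu>' p" "integrable \<mu>' q"
    unfolding p_def q_def using f by auto
  have intK: "integrable (K x) p" "integrable (K x) q" if "x \<in> space N" for x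
    unfolding p_def q_def using fK[OF that] by auto
  have meas: "p \<in> borel_measurable N" "q \<in> borel_measurable N"
    unfolding p_def q_def by measurable
  have P: "integrable \<mu> (\<lambda>x. \<integral>y. p y \<partial>K x) \<and> (\<integral>y. p y \<partial>\<mu>') = (\<integral>x. \<integral>y. p y \<partial>K x \<partial>\<mu>)"
    by (rule integral_kernel_nonneg[OF K sets step meas(1) int(1) _ intK(1)]) (auto simp: p_def)
  have Q: "integrable \<mu> (\<lambda>x. \<integral>y. q y \<partial>K x) \<and> (\<integral>y. q y \<partial>\<mu>') = (\<integral>x. \<integral>y. q y \<partial>K x \<partial>\<mu>)"
    by (rule integral_kernel_nonneg[OF K sets step meas(2) int(2) _ intK(2)]) (auto simp: q_def)
  have [simp]: "space \<mu> = space N"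
    using sets(1) by (rule sets_eq_imp_space_eq)
  have eq: "(\<integral>y. f y \<partial>K x) = (\<integral>y. p y \<partial>K x) - (\<integral>y. q y \<partial>K x)" if "x \<in> space \<mu>" for x
    unfolding f_eq using intK that by simp
  have "(\<integral>x. \<integral>y. f y \<partial>K x \<partial>\<mu>) = (\<integral>x. (\<integral>y. p y \<partial>K x) - (\<integral>y. q y \<partial>K x) \<partial>\<mu>)"
    by (rule Bochner_Integration.integral_cong[OF refl eq])
  also have "\<dots> = (\<integral>y. p y \<partial>\<mu>') - (\<integral>y. q y \<partial>\<mu>')"
    using P Q by simp
  also have "\<dots> = (\<integral>y. f y \<partial>\<mu>')"
    unfolding f_eq using int by simp
  finally show "(\<integral>y. f y \<partial>\<mu>') = (\<integral>x. \<integral>y. f y \<partial>K x \<partial>\<mu>)" ..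
qed

definition kernel_op :: "('a \<Rightarrow> 'a measure) \<Rightarrow> ('a \<Rightarrow> real) \<Rightarrow> 'a \<Rightarrow> real" where
  "kernel_op P f x = (\<integral>y. f y \<partial>P x)"

text \<open>A bound on pairs separates into bounds at single points: every f x - w x lies below
  every f y + w y, so a constant fits in between, and the supremum of the former is one.\<close>

lemma bounded_weighted_oscillation:
  fixes f w :: "'a \<Rightarrow> real"
  assumes "A \<noteq> {}" and osc: "\<And>x y. x \<in> A \<Longrightarrow> y \<in> A \<Longrightarrow> f x - f y \<le> w x + w y"
  shows "\<exists>c. \<forall>x\<in>A. \<bar>f x - c\<bar> \<le> w x"
proof -
  define c where "c = (SUP x\<in>A. f x - w x)"
  have le: "f x - w x \<le> f y + w y" if "x \<in> A" "y \<in> A" for x y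
    using osc[OF that] by simp
  obtain z where "z \<in> A" using \<open>A \<noteq> {}\<close> by auto
  have "bdd_above ((\<lambda>x. f x - w x) ` A)"
    using le[OF _ \<open>z \<in> A\<close>] by (auto intro!: bdd_aboveI)
  then have "f x - w x \<le> c" if "x \<in> A" for x
    unfolding c_def using that by (intro cSUP_upper)
  moreover have "c \<le> f x + w x" if "x \<in> A" for x
    unfolding c_def using le[OF _ that] \<open>A \<noteq> {}\<close> by (intro cSUP_least)
  ultimately show ?thesis
    by (intro exI[of _ c]) (force simp: abs_le_iff)
qed

text \<open>The condition on \<open>R\<close> makes the drift win for pairs far out: V x + V y \<ge>
  R gives \<gamma> (V x + V y) + 2 K < V x + V y. All other pairs lie in \<open>C\<close>, where the
  minorization acts.\<close>

locale harris_kernel = minorized_kernel +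
  fixes V :: "'a \<Rightarrow> real" and \<gamma> K R :: real
  assumes V_meas[measurable]: "V \<in> borel_measurable N"
    and V_ge: "\<And>x. x \<in> space N \<Longrightarrow> 1 \<le> V x"
    and PV: "\<And>x. x \<in> space N \<Longrightarrow> (\<integral>\<^sup>+y. ennreal (V y) \<partial>P x) \<le> ennreal (\<gamma> * V x + K)"
    and \<gamma>: "0 \<le> \<gamma>" "\<gamma> < 1" and K: "0 \<le> K"
    and R: "2 * K < (1 - \<gamma>) * R"
    and small: "\<And>x. x \<in> space N \<Longrightarrow> V x \<le> R \<Longrightarrow> x \<in> C"
begin

lemma PV_bound_nonneg: "x \<in> space N \<Longrightarrow> 0 \<le> \<gamma> * V x + K"
  using V_ge[of x] \<gamma> K by simp

lemma AE_V_P: "x \<in> space N \<Longrightarrow> AE y in P x. 1 \<le> V y"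
  using V_ge by (auto intro!: AE_I2)

lemma integrable_V_P: "x \<in> space N \<Longrightarrow> integrable (P x) V"
proof (rule integrableI_nonneg)
  assume x: "x \<in> space N"
  then show "V \<in> borel_measurable (P x)" by (simp cong: measurable_cong_sets)
  show "AE y in P x. 0 \<le> V y" using AE_V_P[OF x] by eventually_elim simp
  show "(\<integral>\<^sup>+y. ennreal (V y) \<partial>P x) < \<infinity>" using PV[OF x] by (rule le_less_trans) simp
qed

lemma integral_V_P: "x \<in> space N \<Longrightarrow> (\<integral>y. V y \<partial>P x) \<le> \<gamma> * V x + K"
proof -
  assume x: "x \<in> space N"
  have "AE y in P x. 0 \<le> V y" using AE_V_P[OF x] by eventually_elim simp
  then have "ennreal (\<integral>y. V y \<partial>P x) = (\<integral>\<^sup>+y. ennreal (V y) \<partial>P x)"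
    by (rule nn_integral_eq_integral[OF integrable_V_P[OF x], symmetric])
  with PV[OF x] have "ennreal (\<integral>y. V y \<partial>P x) \<le> ennreal (\<gamma> * V x + K)"
    by simp
  then show ?thesis
    by (subst (asm) ennreal_le_iff) (rule PV_bound_nonneg[OF x])
qed

lemma integrable_dominated:
  assumes "sets \<mu> = sets N" "integrable \<mu> V" "f \<in> borel_measurable N"
    and "\<And>x. x \<in> space N \<Longrightarrow> \<bar>f x\<bar> \<le> a * V x"
  shows "integrable \<mu> f"
proof (rule Bochner_Integration.integrable_bound[of \<mu> "\<lambda>x. a * V x"])
  show "AE x in \<mu>. norm (f x) \<le> norm (a * V x)"
    using assms(4) sets_eq_imp_space_eq[OF assms(1)] by (intro AE_I2) fastforce
qed (use assms in \<open>auto cong: measurable_cong_sets\<close>)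

lemma minorization_integral:
  assumes x: "x \<in> C" "x \<in> space N" and f: "f \<in> borel_measurable N" "integrable (P x) f"
    and nonneg: "\<And>y. y \<in> space N \<Longrightarrow> 0 \<le> f y"
  shows "integrable \<nu> f" and "\<epsilon> * (\<integral>y. f y \<partial>\<nu>) \<le> (\<integral>y. f y \<partial>P x)"
proof -
  have AE: "AE y in \<nu>. 0 \<le> f y" "AE y in P x. 0 \<le> f y"
    using nonneg x by (auto intro!: AE_I2)
  have le: "ennreal \<epsilon> * (\<integral>\<^sup>+y. ennreal (f y) \<partial>\<nu>) \<le> (\<integral>\<^sup>+y. ennreal (f y) \<partial>P x)"
    using x f by (subst nn_integral_P) auto
  also have "\<dots> = ennreal (\<integral>y. f y \<partial>P x)"
    by (rule nn_integral_eq_integral[OF f(2) AE(2)])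
  finally have le': "ennreal \<epsilon> * (\<integral>\<^sup>+y. ennreal (f y) \<partial>\<nu>) \<le> ennreal (\<integral>y. f y \<partial>P x)" .
  also have "\<dots> < \<infinity>" by simp
  finally have "(\<integral>\<^sup>+y. ennreal (f y) \<partial>\<nu>) < \<infinity>"
    using \<epsilon>_pos by (auto simp: ennreal_mult_less_top)
  then show int: "integrable \<nu> f"
    using f AE by (intro integrableI_nonneg) (auto cong: measurable_cong_sets)
  have "ennreal \<epsilon> * (\<integral>\<^sup>+y. ennreal (f y) \<partial>\<nu>) = ennreal (\<epsilon> * (\<integral>y. f y \<partial>\<nu>))"
    using \<epsilon>_pos AE by (subst nn_integral_eq_integral[OF int]) (auto simp: ennreal_mult' integral_nonneg_AE)
  with le' show "\<epsilon> * (\<integral>y. f y \<partial>\<nu>) \<le> (\<integral>y. f y \<partial>P x)"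
    using AE(2) by (simp add: ennreal_le_iff integral_nonneg_AE)
qed

text \<open>With |f - c| \<le> w, the difference of \<open>kernel_op P f\<close> at \<open>x\<close>
  and \<open>y\<close> equals the integrals of w under \<open>P x\<close> and \<open>P y\<close>,
  minus those of the nonnegative functions w - (f - c) under \<open>P x\<close> and w + (f - c)
  under \<open>P y\<close>. Far out the latter two are dropped and the drift contracts; on
  \<open>C\<close> minorization keeps at least 2 \<epsilon> s of them.\<close>

lemma kernel_op_contraction:
  fixes f :: "'a \<Rightarrow> real"
  assumes f[measurable]: "f \<in> borel_measurable N" and f_le: "\<And>x. x \<in> space N \<Longrightarrow> \<bar>f x\<bar> \<le> a * V x"
    and osc: "\<And>x y. x \<in> space N \<Longrightarrow> y \<in> space N \<Longrightarrow> f x - f y \<le> s * (2 + \<beta> * V x + \<beta> * V y)"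
    and s: "0 \<le> s" and \<beta>: "0 < \<beta>" "2 * \<beta> * K \<le> \<epsilon>"
    and \<rho>: "1 - \<epsilon> / 2 \<le> \<rho>" "\<gamma> \<le> \<rho>" "2 * (1 - \<rho>) + 2 * \<beta> * K \<le> \<beta> * (\<rho> - \<gamma>) * R"
    and x: "x \<in> space N" and y: "y \<in> space N"
  shows "kernel_op P f x - kernel_op P f y \<le> (\<rho> * s) * (2 + \<beta> * V x + \<beta> * V y)"
proof -
  define w where "w z = s * (1 + \<beta> * V z)" for z
  have w[measurable]: "w \<in> borel_measurable N" unfolding w_def by measurable
  have "space N \<noteq> {}" using x by auto
  moreover have "f x - f y \<le> w x + w y" if "x \<in> space N" "y \<in> space N" for x y
    using osc[OF that] by (simp add: w_def algebra_simps)
  ultimately have "\<exists>c. \<forall>x\<in>space N. \<bar>f x - c\<bar> \<le> w x"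
    by (rule bounded_weighted_oscillation)
  then obtain c where c: "\<And>x. x \<in> space N \<Longrightarrow> \<bar>f x - c\<bar> \<le> w x"
    by blast
  interpret n: prob_space \<nu> by (rule \<nu>_prob)
  have fint: "integrable (P z) f" and wint: "integrable (P z) w"
    and wle: "(\<integral>u. w u \<partial>P z) \<le> s * (1 + \<beta> * (\<gamma> * V z + K))" if z: "z \<in> space N" for z
  proof -
    interpret p: prob_space "P z" by (rule prob_space_P[OF z])
    show "integrable (P z) f"
      by (rule integrable_dominated[OF sets_P[OF z] integrable_V_P[OF z] f f_le])
    show "integrable (P z) w"
      unfolding w_def using integrable_V_P[OF z] by simp
    have "(\<integral>u. w u \<partial>P z) = s * (1 + \<beta> * (\<integral>u. V u \<partial>P z))"
      unfolding w_def using integrable_V_P[OF z] by (simp add: p.prob_space[simplified])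
    also have "\<dots> \<le> s * (1 + \<beta> * (\<gamma> * V z + K))"
      using integral_V_P[OF z] s \<beta> by (intro mult_left_mono add_left_mono) auto
    finally show "(\<integral>u. w u \<partial>P z) \<le> s * (1 + \<beta> * (\<gamma> * V z + K))" .
  qed
  interpret px: prob_space "P x" by (rule prob_space_P[OF x])
  interpret py: prob_space "P y" by (rule prob_space_P[OF y])
  have plus: "(\<integral>u. w u + (f u - c) \<partial>P z) = (\<integral>u. w u \<partial>P z) + (kernel_op P f z - c)"
    and minus: "(\<integral>u. w u - (f u - c) \<partial>P z) = (\<integral>u. w u \<partial>P z) - (kernel_op P f z - c)"
    and int: "integrable (P z) (\<lambda>u. w u + (f u - c))" "integrable (P z) (\<lambda>u. w u - (f u - c))"
    if z: "z \<in> space N" for z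
  proof -
    interpret p: prob_space "P z" by (rule prob_space_P[OF z])
    show "(\<integral>u. w u + (f u - c) \<partial>P z) = (\<integral>u. w u \<partial>P z) + (kernel_op P f z - c)"
      "(\<integral>u. w u - (f u - c) \<partial>P z) = (\<integral>u. w u \<partial>P z) - (kernel_op P f z - c)"
      "integrable (P z) (\<lambda>u. w u + (f u - c))" "integrable (P z) (\<lambda>u. w u - (f u - c))"
      unfolding kernel_op_def using fint[OF z] wint[OF z] z p.prob_space by simp_all
  qed
  have nonneg: "0 \<le> w u + (f u - c)" "0 \<le> w u - (f u - c)" if "u \<in> space N" for u
    using c[OF that] by (auto simp: abs_le_iff)
  have Vx: "1 \<le> V x" "1 \<le> V y" using V_ge x y by auto
  show ?thesis
  proof (cases "V x + V y \<ge> R")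
    case True
    have "0 \<le> (\<integral>u. w u - (f u - c) \<partial>P x)" "0 \<le> (\<integral>u. w u + (f u - c) \<partial>P y)"
      using nonneg x y by (auto intro!: integral_nonneg_AE AE_I2)
    then have "kernel_op P f x - kernel_op P f y \<le> (\<integral>u. w u \<partial>P x) + (\<integral>u. w u \<partial>P y)"
      unfolding plus[OF y] minus[OF x] by simp
    also have "\<dots> \<le> s * (1 + \<beta> * (\<gamma> * V x + K)) + s * (1 + \<beta> * (\<gamma> * V y + K))"
      by (intro add_mono wle x y)
    also have "\<dots> = s * (2 + \<beta> * (\<gamma> * (V x + V y)) + 2 * \<beta> * K)"
      by (simp add: algebra_simps)
    also have "\<dots> \<le> s * (\<rho> * (2 + \<beta> * (V x + V y)))"
    proof (rule mult_left_mono[OF _ s])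
      have "2 * (1 - \<rho>) + 2 * \<beta> * K \<le> \<beta> * (\<rho> - \<gamma>) * (V x + V y)"
        by (rule order_trans[OF \<rho>(3)], rule mult_left_mono) (use True \<beta> \<rho> in auto)
      then show "2 + \<beta> * (\<gamma> * (V x + V y)) + 2 * \<beta> * K \<le> \<rho> * (2 + \<beta> * (V x + V y))"
        by (simp add: algebra_simps)
    qed
    finally show ?thesis by (simp add: algebra_simps)
  next
    case False
    then have "x \<in> C" "y \<in> C"
      using Vx small x y by auto
    have "\<epsilon> * (\<integral>u. w u - (f u - c) \<partial>\<nu>) \<le> (\<integral>u. w u - (f u - c) \<partial>P x)"
      and intm: "integrable \<nu> (\<lambda>u. w u - (f u - c))"
      using minorization_integral[OF \<open>x \<in> C\<close> x _ int(2)[OF x] nonneg(2)] by auto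
    moreover have "\<epsilon> * (\<integral>u. w u + (f u - c) \<partial>\<nu>) \<le> (\<integral>u. w u + (f u - c) \<partial>P y)"
      and intp: "integrable \<nu> (\<lambda>u. w u + (f u - c))"
      using minorization_integral[OF \<open>y \<in> C\<close> y _ int(1)[OF y] nonneg(1)] by auto
    \<comment> \<open>Both integrals are now taken under the same \<open>\<nu>\<close>, so f - c
      cancels and 2 w \<ge> 2 s remains.\<close>
    moreover have "(\<integral>u. w u - (f u - c) \<partial>\<nu>) + (\<integral>u. w u + (f u - c) \<partial>\<nu>) \<ge> 2 * s"
    proof -
      have "2 * s = (\<integral>u. 2 * s \<partial>\<nu>)"
        using n.prob_space by simp
      also have "\<dots> \<le> (\<integral>u. (w u - (f u - c)) + (w u + (f u - c)) \<partial>\<nu>)"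
      proof (rule integral_mono)
        fix u assume "u \<in> space \<nu>"
        then have "0 \<le> s * (\<beta> * V u)"
          using V_ge[of u] s \<beta> by simp
        then show "2 * s \<le> (w u - (f u - c)) + (w u + (f u - c))"
          by (simp add: w_def algebra_simps)
      qed (simp, rule Bochner_Integration.integrable_add[OF intm intp])
      also have "\<dots> = (\<integral>u. w u - (f u - c) \<partial>\<nu>) + (\<integral>u. w u + (f u - c) \<partial>\<nu>)"
        by (rule Bochner_Integration.integral_add[OF intm intp])
      finally show ?thesis .
    qed
    then have "\<epsilon> * (2 * s) \<le> \<epsilon> * (\<integral>u. w u - (f u - c) \<partial>\<nu>) + \<epsilon> * (\<integral>u. w u + (f u - c) \<partial>\<nu>)"
      unfolding distrib_left[symmetric] using \<epsilon>_pos by (intro mult_left_mono) auto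
    ultimately have "kernel_op P f x - kernel_op P f y \<le> (\<integral>u. w u \<partial>P x) + (\<integral>u. w u \<partial>P y) - \<epsilon> * (2 * s)"
      unfolding plus[OF y] minus[OF x] by linarith
    also have "\<dots> \<le> s * (1 + \<beta> * (\<gamma> * V x + K)) + s * (1 + \<beta> * (\<gamma> * V y + K)) - \<epsilon> * (2 * s)"
      by (intro diff_right_mono add_mono wle x y)
    also have "\<dots> = s * (2 - 2 * \<epsilon> + 2 * \<beta> * K + \<gamma> * (\<beta> * (V x + V y)))"
      by (simp add: algebra_simps)
    \<comment> \<open>Here 2 - 2 \<epsilon> + 2 \<beta> K \<le> 2 - \<epsilon> \<le> 2 \<rho>: half
      of the gain from minorization pays for \<open>K\<close>.\<close>
    also have "\<dots> \<le> s * (\<rho> * 2 + \<rho> * (\<beta> * (V x + V y)))"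
      using \<beta> \<rho> Vx s by (intro mult_left_mono add_mono mult_right_mono) auto
    finally show ?thesis by (simp add: algebra_simps)
  qed
qed

section \<open>Iterates of the kernel on weighted functions\<close>

lemma kernel_op_measurable[measurable]:
  "f \<in> borel_measurable N \<Longrightarrow> kernel_op P f \<in> borel_measurable N"
  unfolding kernel_op_def
  by (rule measurable_compose[OF P_subprob integral_measurable_subprob_algebra])

lemma kernel_op_funpow_measurable[measurable]:
  "f \<in> borel_measurable N \<Longrightarrow> (kernel_op P ^^ n) f \<in> borel_measurable N"
  by (induction n) auto

lemma kernel_op_dominated:
  assumes f: "f \<in> borel_measurable N" "\<And>x. x \<in> space N \<Longrightarrow> \<bar>f x\<bar> \<le> a * V x" and a: "0 \<le> a"
    and x: "x \<in> space N"
  shows "\<bar>kernel_op P f x\<bar> \<le> (a * (\<gamma> + K)) * V x"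
proof -
  have "\<bar>kernel_op P f x\<bar> \<le> (\<integral>y. \<bar>f y\<bar> \<partial>P x)"
    unfolding kernel_op_def by (rule integral_abs_bound)
  also have "\<dots> \<le> (\<integral>y. a * V y \<partial>P x)"
    using integrable_dominated[OF sets_P[OF x] integrable_V_P[OF x] f] integrable_V_P[OF x] f(2) x
    by (intro integral_mono) auto
  also have "\<dots> \<le> a * (\<gamma> * V x + K)"
    using integral_V_P[OF x] a by (simp add: mult_left_mono)
  also have "\<dots> \<le> a * (\<gamma> * V x + K * V x)"
    using V_ge[OF x] a K by (intro mult_left_mono add_left_mono) (auto simp: mult_le_cancel_left1)
  finally show ?thesis by (simp add: algebra_simps)
qed

lemma kernel_op_funpow_dominated:
  assumes f: "f \<in> borel_measurable N" "\<And>x. x \<in> space N \<Longrightarrow> \<bar>f x\<bar> \<le> a * V x" and a: "0 \<le> a"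
  shows "x \<in> space N \<Longrightarrow> \<bar>(kernel_op P ^^ n) f x\<bar> \<le> (a * (\<gamma> + K) ^ n) * V x"
proof (induction n arbitrary: x)
  case (Suc n)
  have "\<bar>kernel_op P ((kernel_op P ^^ n) f) x\<bar> \<le> (a * (\<gamma> + K) ^ n * (\<gamma> + K)) * V x"
    by (rule kernel_op_dominated) (use Suc f a \<gamma> K in auto)
  then show ?case by (simp add: ac_simps)
qed (simp add: f)

text \<open>\<open>\<delta>\<close> is the slack in the condition on \<open>R\<close>. The last
  inequality is (1 - \<rho>) (2 + \<beta> R) \<le> \<beta> \<delta> rearranged, whence the last
  entry of the maximum; the entry 1/2 only keeps \<open>\<rho>\<close> positive.\<close>

lemma contraction_constants:
  obtains \<beta> \<rho> where "0 < \<beta>" "2 * \<beta> * K \<le> \<epsilon>" "0 < \<rho>" "\<rho> < 1"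
    "1 - \<epsilon> / 2 \<le> \<rho>" "\<gamma> \<le> \<rho>" "2 * (1 - \<rho>) + 2 * \<beta> * K \<le> \<beta> * (\<rho> - \<gamma>) * R"
proof -
  define \<beta> where "\<beta> = \<epsilon> / (2 * K + 1)"
  define \<delta> where "\<delta> = (1 - \<gamma>) * R - 2 * K"
  define \<rho> where "\<rho> = max (max (1 - \<epsilon> / 2) \<gamma>) (max (1 / 2) (1 - \<beta> * \<delta> / (2 + \<beta> * R)))"
  have \<beta>: "0 < \<beta>" using \<epsilon>_pos K by (simp add: \<beta>_def)
  have \<delta>: "0 < \<delta>" using R by (simp add: \<delta>_def)
  have "0 < (1 - \<gamma>) * R" using R K by linarith
  then have "0 < R" using \<gamma> by (simp add: zero_less_mult_iff)
  then have pos: "0 < 2 + \<beta> * R" using \<beta> by (simp add: add_pos_pos)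
  have "1 - \<rho> \<le> \<beta> * \<delta> / (2 + \<beta> * R)" by (simp add: \<rho>_def)
  then have "(1 - \<rho>) * (2 + \<beta> * R) \<le> \<beta> * \<delta>"
    using pos by (simp add: pos_le_divide_eq)
  then have *: "2 * (1 - \<rho>) + 2 * \<beta> * K \<le> \<beta> * (\<rho> - \<gamma>) * R"
    by (simp add: \<delta>_def algebra_simps)
  show ?thesis
  proof (rule that[OF \<beta> _ _ _ _ _ *])
    show "2 * \<beta> * K \<le> \<epsilon>"
      using \<epsilon>_pos K by (simp add: \<beta>_def field_simps)
  qed (use \<epsilon>_pos \<gamma> \<beta> \<delta> pos in \<open>auto simp: \<rho>_def\<close>)
qed

theorem geometric_ergodicity:
  assumes \<pi>: "prob_space \<pi>" "sets \<pi> = sets N" "(\<integral>\<^sup>+x. ennreal (V x) \<partial>\<pi>) < \<infinity>"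
    and inv: "\<And>A. A \<in> sets N \<Longrightarrow> (\<integral>\<^sup>+x. emeasure (P x) A \<partial>\<pi>) = emeasure \<pi> A"
  obtains r L where "0 < r" "r < 1" "0 < L"
    "\<And>f x n. f \<in> borel_measurable N \<Longrightarrow> (\<And>x. x \<in> space N \<Longrightarrow> \<bar>f x\<bar> \<le> V x) \<Longrightarrow> x \<in> space N \<Longrightarrow>
      \<bar>(kernel_op P ^^ n) f x - (\<integral>y. f y \<partial>\<pi>)\<bar> \<le> L * r ^ n * V x"
proof -
  obtain \<beta> \<rho> where \<beta>: "0 < \<beta>" "2 * \<beta> * K \<le> \<epsilon>" and \<rho>: "0 < \<rho>" "\<rho> < 1"
    "1 - \<epsilon> / 2 \<le> \<rho>" "\<gamma> \<le> \<rho>" "2 * (1 - \<rho>) + 2 * \<beta> * K \<le> \<beta> * (\<rho> - \<gamma>) * R"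
    by (rule contraction_constants)
  interpret p: prob_space \<pi> by fact
  note [measurable_cong] = \<pi>(2)
  have [simp]: "space \<pi> = space N"
    using \<pi>(2) by (rule sets_eq_imp_space_eq)
  have V_int: "integrable \<pi> V"
    using V_ge \<pi>(3) by (intro integrableI_nonneg) (auto intro!: AE_I2 order_trans[OF zero_le_one])
  have inv': "(\<integral>\<^sup>+x. h x \<partial>\<pi>) = (\<integral>\<^sup>+x. \<integral>\<^sup>+y. h y \<partial>P x \<partial>\<pi>)" if "h \<in> borel_measurable N" for h
    by (rule nn_integral_invariant[OF \<pi>(2,1) inv that, symmetric])
  define v where "v = (\<integral>x. V x \<partial>\<pi>)"
  have "0 \<le> v"
    unfolding v_def using V_ge by (intro integral_nonneg_AE AE_I2) (auto intro: order_trans[OF zero_le_one])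
  \<comment> \<open>Averaging 2 + \<beta> V x + \<beta> V y over y under \<open>\<pi>\<close> and
    absorbing constants by 1 \<le> V x gives the numerator. The factor 1 / \<beta> is the
    oscillation bound at n = 0, where f x - f y \<le> V x + V y.\<close>
  define L where "L = (2 + \<beta> + \<beta> * v) / \<beta>"
  show ?thesis
  proof (rule that[of \<rho> L])
    show "0 < \<rho>" "\<rho> < 1" by fact+
    show "0 < L" using \<beta>(1) \<open>0 \<le> v\<close> by (auto simp: L_def intro!: divide_pos_pos add_pos_nonneg)
  next
    fix f x n
    assume f[measurable]: "f \<in> borel_measurable N" and f_le: "\<And>x. x \<in> space N \<Longrightarrow> \<bar>f x\<bar> \<le> V x"
      and x: "x \<in> space N"
    have f_le1: "\<And>x. x \<in> space N \<Longrightarrow> \<bar>f x\<bar> \<le> 1 * V x" using f_le by simp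
    note dom = kernel_op_funpow_dominated[OF f f_le1 zero_le_one]
    have int: "integrable \<pi> ((kernel_op P ^^ n) f)" for n
      by (rule integrable_dominated[OF \<pi>(2) V_int _ dom]) auto
    have int_eq: "(\<integral>y. (kernel_op P ^^ n) f y \<partial>\<pi>) = (\<integral>y. f y \<partial>\<pi>)" for n
    proof (induction n)
      case (Suc n)
      have "(\<integral>y. (kernel_op P ^^ n) f y \<partial>\<pi>) = (\<integral>y. kernel_op P ((kernel_op P ^^ n) f) y \<partial>\<pi>)"
        unfolding kernel_op_def[of P "(kernel_op P ^^ n) f"]
        by (rule integral_kernel[OF P_subprob \<pi>(2) \<pi>(2) inv' _ int],
            assumption, measurable, rule integrable_dominated[OF sets_P integrable_V_P _ dom]) auto
      with Suc show ?case by simp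
    qed simp
    have osc: "(kernel_op P ^^ n) f x - (kernel_op P ^^ n) f y \<le> (\<rho> ^ n / \<beta>) * (2 + \<beta> * V x + \<beta> * V y)"
      if "x \<in> space N" "y \<in> space N" for x y
      using that
    proof (induction n arbitrary: x y)
      case 0
      have "f x - f y \<le> V x + V y"
        using f_le[OF 0(1)] f_le[OF 0(2)] by linarith
      also have "\<dots> \<le> 1 / \<beta> * (2 + \<beta> * V x + \<beta> * V y)"
        using \<beta>(1) by (simp add: field_simps)
      finally show ?case by simp
    next
      case (Suc n)
      have "kernel_op P ((kernel_op P ^^ n) f) x - kernel_op P ((kernel_op P ^^ n) f) y
          \<le> (\<rho> * (\<rho> ^ n / \<beta>)) * (2 + \<beta> * V x + \<beta> * V y)"
        by (rule kernel_op_contraction[OF _ dom Suc.IH]) (use Suc.prems \<beta> \<rho> in auto)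
      then show ?case by simp
    qed
    have osc': "\<bar>(kernel_op P ^^ n) f x - (kernel_op P ^^ n) f y\<bar> \<le> (\<rho> ^ n / \<beta>) * (2 + \<beta> * V x + \<beta> * V y)"
      if "y \<in> space N" for y
      using osc[OF x that] osc[OF that x] by (simp add: abs_le_iff ac_simps)
    have "\<bar>(kernel_op P ^^ n) f x - (\<integral>y. f y \<partial>\<pi>)\<bar>
        = \<bar>\<integral>y. (kernel_op P ^^ n) f x - (kernel_op P ^^ n) f y \<partial>\<pi>\<bar>"
      using int p.prob_space by (simp add: int_eq)
    also have "\<dots> \<le> (\<integral>y. \<bar>(kernel_op P ^^ n) f x - (kernel_op P ^^ n) f y\<bar> \<partial>\<pi>)"
      by (rule integral_abs_bound)
    also have "\<dots> \<le> (\<integral>y. (\<rho> ^ n / \<beta>) * (2 + \<beta> * V x + \<beta> * V y) \<partial>\<pi>)"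
      using osc' int V_int by (intro integral_mono) auto
    also have "\<dots> = (\<rho> ^ n / \<beta>) * (2 + \<beta> * V x + \<beta> * v)"
      using V_int p.prob_space by (simp add: v_def)
    also have "\<dots> \<le> (\<rho> ^ n / \<beta>) * (2 * V x + \<beta> * V x + (\<beta> * v) * V x)"
      using V_ge[OF x] \<beta>(1) \<rho>(1) mult_nonneg_nonneg[OF less_imp_le[OF \<beta>(1)] \<open>0 \<le> v\<close>]
      by (intro mult_left_mono add_mono) (auto simp: mult_le_cancel_left1)
    also have "\<dots> = L * \<rho> ^ n * V x"
      by (simp add: L_def algebra_simps add_divide_distrib)
    finally show "\<bar>(kernel_op P ^^ n) f x - (\<integral>y. f y \<partial>\<pi>)\<bar> \<le> L * \<rho> ^ n * V x" .
  qed
qed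

lemma
  assumes law_sets: "\<And>n. sets (law n) = sets N"
    and law_0: "law 0 = return N x" and x: "x \<in> space N"
    and law_Suc: "\<And>n h. h \<in> borel_measurable N \<Longrightarrow>
      (\<integral>\<^sup>+y. h y \<partial>law (Suc n)) = (\<integral>\<^sup>+y. \<integral>\<^sup>+z. h z \<partial>P y \<partial>law n)"
    and prob: "\<And>n. prob_space (law n)"
    and f: "f \<in> borel_measurable N" "\<And>x. x \<in> space N \<Longrightarrow> \<bar>f x\<bar> \<le> a * V x" and a: "0 \<le> a"
  shows integrable_chain: "integrable (law n) f"
    and integral_chain: "(\<integral>y. f y \<partial>law n) = (kernel_op P ^^ n) f x"
proof -
  note [measurable_cong] = law_sets
  have [simp]: "space (law n) = space N" for n
    using law_sets by (rule sets_eq_imp_space_eq)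
  have V_pos: "y \<in> space N \<Longrightarrow> 0 \<le> V y" for y
    using V_ge[of y] by simp
  have "(\<integral>\<^sup>+y. ennreal (V y) \<partial>law n) < \<infinity>" for n
  proof (induction n)
    case 0
    show ?case using x by (simp add: law_0 nn_integral_return)
  next
    case (Suc n)
    have "(\<integral>\<^sup>+y. ennreal (V y) \<partial>law (Suc n)) \<le> (\<integral>\<^sup>+y. ennreal \<gamma> * ennreal (V y) + ennreal K \<partial>law n)"
      unfolding law_Suc[of "\<lambda>y. ennreal (V y)", simplified] using PV \<gamma> K V_pos
      by (intro nn_integral_mono) (simp add: ennreal_mult[symmetric] ennreal_plus[symmetric] del: ennreal_plus)
    also have "\<dots> = ennreal \<gamma> * (\<integral>\<^sup>+y. ennreal (V y) \<partial>law n) + ennreal K"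
      using prob_space.emeasure_space_1[OF prob[of n]]
      by (subst nn_integral_add) (simp_all add: nn_integral_cmult)
    also have "\<dots> < \<infinity>"
      using Suc by (simp add: ennreal_mult_less_top)
    finally show ?case .
  qed
  then have V_int: "integrable (law n) V" for n
    using V_pos by (intro integrableI_nonneg AE_I2) auto
  show "integrable (law n) f" for n
    by (rule integrable_dominated[OF law_sets V_int f])
  \<comment> \<open>The last step is peeled off, which replaces \<open>f\<close> by
    \<open>kernel_op P f\<close>; hence \<open>f\<close> and its bound \<open>a\<close> vary in the
    induction.\<close>
  show "(\<integral>y. f y \<partial>law n) = (kernel_op P ^^ n) f x" for n
    using f a
  proof (induction n arbitrary: f a)
    case 0
    then show ?case using x by (simp add: law_0 integral_return)
  next
    case (Suc n)
    have "(\<integral>y. f y \<partial>law (Suc n)) = (\<integral>y. kernel_op P f y \<partial>law n)"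
      unfolding kernel_op_def
      by (rule integral_kernel[OF P_subprob law_sets law_sets law_Suc])
         (auto intro!: integrable_dominated[OF law_sets V_int] integrable_dominated[OF sets_P integrable_V_P] Suc.prems)
    also have "\<dots> = (kernel_op P ^^ n) (kernel_op P f) x"
      by (rule Suc.IH[where a="a * (\<gamma> + K)"])
         (use Suc.prems \<gamma> K kernel_op_dominated[OF Suc.prems] in auto)
    finally show ?case
      by (simp add: funpow_Suc_right del: funpow.simps)
  qed
qed

end

subsection \<open>Affine images of Gaussian measures\<close>

lemma nn_integral_lborel_translate:
  fixes f :: "'a::euclidean_space \<Rightarrow> ennreal"
  assumes [measurable]: "f \<in> borel_measurable borel"
  shows "(\<integral>\<^sup>+x. f (c + x) \<partial>lborel) = (\<integral>\<^sup>+x. f x \<partial>lborel)"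
  by (subst (2) lborel_distr_plus[of c, symmetric]) (simp add: nn_integral_distr)

text \<open>The law of \<open>t + A z\<close> is compared with Lebesgue measure without computing its density:
  translating \<open>z\<close> by \<open>B u\<close> translates \<open>t + A z\<close> by \<open>u\<close>, and averaging over \<open>u\<close> in a ball
  produces Lebesgue measure.\<close>
lemma affine_image_density_ge:
  fixes A :: "'b::euclidean_space \<Rightarrow> 'a::euclidean_space" and B :: "'a \<Rightarrow> 'b"
  assumes A: "linear A" and AB: "\<And>u. A (B u) = u"
    and f[measurable]: "f \<in> borel_measurable borel" and D[measurable]: "D \<in> sets borel"
    and D_sub: "D \<subseteq> ball 0 1" 
    and tA: "\<And>z. z \<in> ball 0 1 \<Longrightarrow> norm (t + A z) \<le> \<rho>"
    and fc: "\<And>u z. u \<in> ball 0 (1 + \<rho>) \<Longrightarrow> z \<in> ball 0 1 \<Longrightarrow> c \<le> f (B u + z)"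
  shows "c * emeasure lborel (ball 0 1 :: 'b set) * emeasure lborel D
    \<le> emeasure lborel (ball 0 (1 + \<rho>) :: 'a set) * (\<integral>\<^sup>+z. f z * indicator D (t + A z) \<partial>lborel)"
proof -
  have [measurable]: "A \<in> borel_measurable borel"
    using A by (intro borel_measurable_continuous_onI linear_continuous_on linear_conv_bounded_linear[THEN iffD1])
  have "c * emeasure lborel (ball 0 1 :: 'b set) * emeasure lborel D
      = (\<integral>\<^sup>+z. c * emeasure lborel D * indicator (ball 0 1) z \<partial>(lborel :: 'b measure))"
    by (subst nn_integral_cmult_indicator) (simp_all add: ac_simps)
  also have "\<dots> = (\<integral>\<^sup>+z. \<integral>\<^sup>+u. c * indicator (ball 0 1) z * (indicator (ball 0 (1 + \<rho>)) u * indicator D (t + A z + u)) \<partial>lborel \<partial>lborel)"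
  proof (rule nn_integral_cong)
    fix z :: 'b
    have "(\<integral>\<^sup>+u. c * indicator (ball 0 1) z * (indicator (ball 0 (1 + \<rho>)) u * indicator D (t + A z + u)) \<partial>lborel)
      = (\<integral>\<^sup>+u. c * indicator (ball 0 1) z * indicator D (t + A z + u) \<partial>lborel)"
    proof (rule nn_integral_cong)
      fix u :: 'a
      \<comment> \<open>The cutoff in u is free: t + A z has norm at most \<rho> and its translate
        by u lies in the unit ball. It makes the later average over u have finite volume.\<close>
      have "u \<in> ball 0 (1 + \<rho>)" if "t + A z + u \<in> D" "z \<in> ball 0 1"
      proof -
        have "norm u \<le> norm (t + A z + u) + norm (t + A z)"
          using norm_triangle_ineq4[of "t + A z + u" "t + A z"] by simp
        also have "\<dots> < 1 + \<rho>"
          using tA[OF that(2)] that(1) D_sub by fastforce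
        finally show ?thesis by simp
      qed
      then show "c * indicator (ball 0 1) z * (indicator (ball 0 (1 + \<rho>)) u * indicator D (t + A z + u))
          = c * indicator (ball 0 1) z * indicator D (t + A z + u)"
        by (auto simp: indicator_def)
    qed
    also have "\<dots> = c * indicator (ball 0 1) z * emeasure lborel D"
      using nn_integral_lborel_translate[of "\<lambda>u. c * indicator (ball 0 1) z * indicator D u" "t + A z"]
      by (simp add: nn_integral_cmult)
    finally show "c * emeasure lborel D * indicator (ball 0 1) z
      = (\<integral>\<^sup>+u. c * indicator (ball 0 1) z * (indicator (ball 0 (1 + \<rho>)) u * indicator D (t + A z + u)) \<partial>lborel)"
      by (simp add: ac_simps)
  qed
  also have "\<dots> = (\<integral>\<^sup>+u. \<integral>\<^sup>+z. c * indicator (ball 0 1) z * (indicator (ball 0 (1 + \<rho>)) u * indicator D (t + A z + u)) \<partial>lborel \<partial>lborel)"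
  proof (rule lborel_pair.Fubini'[symmetric])
    have "(\<lambda>p. indicator (ball 0 1) (fst p) :: ennreal) \<in> borel_measurable (lborel \<Otimes>\<^sub>M lborel)"
      by (rule measurable_compose[OF measurable_fst borel_measurable_indicator]) simp
    moreover have "(\<lambda>p. indicator (ball 0 (1 + \<rho>)) (snd p) :: ennreal) \<in> borel_measurable (lborel \<Otimes>\<^sub>M lborel)"
      by (rule measurable_compose[OF measurable_snd borel_measurable_indicator]) simp
    moreover have "(\<lambda>p. indicator D (t + A (fst p) + snd p) :: ennreal) \<in> borel_measurable (lborel \<Otimes>\<^sub>M lborel)"
      by (rule measurable_compose[OF _ borel_measurable_indicator[OF D]]) measurable
    ultimately show "(\<lambda>(z, u). c * indicator (ball 0 1) z * (indicator (ball 0 (1 + \<rho>)) u * indicator D (t + A z + u)))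
        \<in> borel_measurable (lborel \<Otimes>\<^sub>M lborel)"
      unfolding split_beta' by (intro borel_measurable_times_ennreal borel_measurable_const)
  qed
  also have "\<dots> \<le> (\<integral>\<^sup>+u. indicator (ball 0 (1 + \<rho>)) u * (\<integral>\<^sup>+z. f z * indicator D (t + A z) \<partial>lborel) \<partial>(lborel :: 'a measure))"
  proof (rule nn_integral_mono)
    fix u :: 'a
    have "(\<integral>\<^sup>+z. c * indicator (ball 0 1) z * (indicator (ball 0 (1 + \<rho>)) u * indicator D (t + A z + u)) \<partial>lborel)
      \<le> (\<integral>\<^sup>+z. indicator (ball 0 (1 + \<rho>)) u * (f (B u + z) * indicator D (t + A (B u + z))) \<partial>lborel)"
    proof (rule nn_integral_mono)
      fix z :: 'b
      \<comment> \<open>Translating z by \<open>B u\<close> replaces the constant c by the density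
        itself; translation invariance then removes u from the inner integral.\<close>
      have eq: "t + A (B u + z) = t + A z + u"
        by (simp add: linear_add[OF A] AB)
      show "c * indicator (ball 0 1) z * (indicator (ball 0 (1 + \<rho>)) u * indicator D (t + A z + u))
          \<le> indicator (ball 0 (1 + \<rho>)) u * (f (B u + z) * indicator D (t + A (B u + z)))"
        unfolding eq using fc[of u z] by (simp add: indicator_def)
    qed
    also have "\<dots> = indicator (ball 0 (1 + \<rho>)) u * (\<integral>\<^sup>+z. f z * indicator D (t + A z) \<partial>lborel)"
      by (subst nn_integral_cmult)
         (simp_all add: nn_integral_lborel_translate[of "\<lambda>z. f z * indicator D (t + A z)"])
    finally show "(\<integral>\<^sup>+z. c * indicator (ball 0 1) z * (indicator (ball 0 (1 + \<rho>)) u * indicator D (t + A z + u)) \<partial>lborel)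
      \<le> indicator (ball 0 (1 + \<rho>)) u * (\<integral>\<^sup>+z. f z * indicator D (t + A z) \<partial>lborel)" .
  qed
  also have "\<dots> = emeasure lborel (ball 0 (1 + \<rho>) :: 'a set) * (\<integral>\<^sup>+z. f z * indicator D (t + A z) \<partial>lborel)"
    by (subst nn_integral_multc) (simp_all add: borel_measurable_indicator)
  finally show ?thesis .
qed

section \<open>Gaussian vectors and their second moments\<close>

lemma
  fixes h :: "'m::finite \<Rightarrow> real \<Rightarrow> real"
  assumes h: "\<And>i. integrable lborel (h i)"
  shows integrable_lborel_vec_prod: "integrable lborel (\<lambda>x::real^'m. \<Prod>i\<in>UNIV. h i (x $ i))"
    and integral_lborel_vec_prod:
      "(\<integral>x. (\<Prod>i\<in>UNIV. h i (x $ i)) \<partial>(lborel :: (real^'m) measure)) = (\<Prod>i\<in>UNIV. \<integral>x. h i x \<partial>lborel)"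
proof -
  let ?e = "\<lambda>i::'m. axis i (1::real)"
  \<comment> \<open>Lebesgue measure on vectors is the image of a product indexed by basis vectors;
    \<open>k\<close> translates a basis vector back to its coordinate.\<close>
  define k where "k b = (THE i. b = ?e i)" for b
  have k[simp]: "k (?e i) = i" for i
    by (auto simp: k_def axis_eq_axis)
  have Basis: "Basis = range ?e" and inj: "inj ?e"
    by (auto simp: Basis_vec_def inj_on_def axis_eq_axis)
  interpret product_sigma_finite "\<lambda>_::real^'m. lborel :: real measure" ..
  let ?M = "\<Pi>\<^sub>M b\<in>(Basis::(real^'m) set). (lborel :: real measure)"
  let ?s = "\<lambda>f. \<Sum>b\<in>(Basis::(real^'m) set). f b *\<^sub>R b"
  have comp: "?s f $ i = f (?e i)" for f i
  proof -
    have "?s f $ i = ?s f \<bullet> ?e i" by (simp add: cart_eq_inner_axis)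
    also have "\<dots> = f (?e i)" by (intro inner_sum_left_Basis) (auto simp: Basis)
    finally show ?thesis .
  qed
  have eq: "(\<Prod>i\<in>UNIV. h i (?s f $ i)) = (\<Prod>b\<in>Basis. h (k b) (f b))" for f
    unfolding comp unfolding Basis by (subst prod.reindex[OF inj]) simp
  have [measurable]: "h i \<in> borel_measurable borel" for i
    using h[of i] by simp
  have s: "?s \<in> ?M \<rightarrow>\<^sub>M borel" by measurable
  show "integrable lborel (\<lambda>x::real^'m. \<Prod>i\<in>UNIV. h i (x $ i))"
    by (subst lborel_eq, subst integrable_distr_eq[OF s])
       (simp, unfold eq, intro product_integrable_prod h, simp)
  have "(\<integral>x. (\<Prod>i\<in>UNIV. h i (x $ i)) \<partial>(lborel :: (real^'m) measure)) = (\<integral>f. (\<Prod>b\<in>Basis. h (k b) (f b)) \<partial>?M)"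
    by (subst lborel_eq, subst integral_distr[OF s]) (simp, unfold eq, simp)
  also have "\<dots> = (\<Prod>b\<in>Basis. \<integral>x. h (k b) x \<partial>lborel)"
    by (intro product_integral_prod h) simp
  also have "\<dots> = (\<Prod>i\<in>UNIV. \<integral>x. h i x \<partial>lborel)"
    unfolding Basis by (subst prod.reindex[OF inj]) simp
  finally show "(\<integral>x. (\<Prod>i\<in>UNIV. h i (x $ i)) \<partial>(lborel :: (real^'m) measure)) = (\<Prod>i\<in>UNIV. \<integral>x. h i x \<partial>lborel)" .
qed

definition vec_normal_density :: "real \<Rightarrow> real ^ 'm \<Rightarrow> real" where
  "vec_normal_density s z = (\<Prod>i\<in>UNIV. normal_density 0 s (z $ i))"

lemma vec_normal_density_measurable[measurable]: "vec_normal_density s \<in> borel_measurable borel"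
  unfolding vec_normal_density_def by measurable

lemma vec_normal_density_nonneg: "0 \<le> vec_normal_density s z"
  unfolding vec_normal_density_def by (intro prod_nonneg) simp

text \<open>\<open>s\<close> is the standard deviation of each coordinate, so the covariance is s^2
  I and a Wiener increment over time \<tau> has s = sqrt \<tau>.\<close>

definition gaussian :: "real \<Rightarrow> (real ^ 'm) measure" where
  "gaussian s = density lborel (\<lambda>z. ennreal (vec_normal_density s z))"

lemma sets_gaussian[measurable_cong, simp]: "sets (gaussian s) = sets borel"
  and space_gaussian[simp]: "space (gaussian s) = UNIV"
  by (simp_all add: gaussian_def)

text \<open>Independence of the coordinates. Total mass and low moments come from setting all
  factors but at most two equal to 1.\<close>

lemma has_bochner_integral_gaussian_prod:
  fixes h :: "'m::finite \<Rightarrow> real \<Rightarrow> real"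
  assumes h: "\<And>i. has_bochner_integral lborel (\<lambda>x. normal_density 0 s x * h i x) (v i)"
    and [measurable]: "\<And>i. h i \<in> borel_measurable borel"
  shows "has_bochner_integral (gaussian s) (\<lambda>z. \<Prod>i\<in>UNIV. h i (z $ i)) (\<Prod>i\<in>UNIV. v i)"
proof -
  have h': "integrable lborel (\<lambda>x. normal_density 0 s x * h i x)"
      "(\<integral>x. normal_density 0 s x * h i x \<partial>lborel) = v i" for i
    using h[of i] by (simp_all add: has_bochner_integral_iff)
  have "has_bochner_integral lborel (\<lambda>z::real^'m. \<Prod>i\<in>UNIV. normal_density 0 s (z $ i) * h i (z $ i)) (\<Prod>i\<in>UNIV. v i)"
    using integrable_lborel_vec_prod[of "\<lambda>i x. normal_density 0 s x * h i x"]
      integral_lborel_vec_prod[of "\<lambda>i x. normal_density 0 s x * h i x"]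
    by (simp add: has_bochner_integral_iff h')
  then have "has_bochner_integral lborel (\<lambda>z. vec_normal_density s z *\<^sub>R (\<Prod>i\<in>UNIV. h i (z $ i))) (\<Prod>i\<in>UNIV. v i)"
    by (simp add: vec_normal_density_def prod.distrib)
  then show ?thesis
    unfolding gaussian_def
    by (intro has_bochner_integral_density) (auto intro: vec_normal_density_nonneg)
qed

lemma
  fixes i j :: "'m::finite"
  assumes s: "0 < s"
  shows gaussian_mass: "has_bochner_integral (gaussian s) (\<lambda>z::real^'m. 1::real) 1"
    and gaussian_moment1: "has_bochner_integral (gaussian s) (\<lambda>z. z $ i) 0"
    and gaussian_moment2: "has_bochner_integral (gaussian s) (\<lambda>z. z $ i * z $ j) (if i = j then s\<^sup>2 else 0)"
proof -
  have m0: "has_bochner_integral lborel (\<lambda>x. normal_density 0 s x * 1) 1"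
    using normal_moment_even[OF s, of 0 0] by simp
  have m1: "has_bochner_integral lborel (\<lambda>x. normal_density 0 s x * x) 0"
    using normal_moment_odd[OF s, of 0 0] by simp
  have m2: "has_bochner_integral lborel (\<lambda>x. normal_density 0 s x * (x * x)) (s\<^sup>2)"
    using normal_moment_even[OF s, of 0 1] by (simp add: power2_eq_square fact_2)
  show "has_bochner_integral (gaussian s) (\<lambda>z::real^'m. 1::real) 1"
    using has_bochner_integral_gaussian_prod[of s "\<lambda>(_::'m) _. 1" "\<lambda>_. 1"] m0 by simp
  show "has_bochner_integral (gaussian s) (\<lambda>z. z $ i) 0"
  proof -
    have "has_bochner_integral (gaussian s) (\<lambda>z::real^'m. \<Prod>k\<in>UNIV. if k = i then z $ k else 1)
        (\<Prod>k\<in>UNIV. if k = i then 0 else 1)"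
      by (rule has_bochner_integral_gaussian_prod[where h="\<lambda>k x. if k = i then x else 1"])
         (use m0 m1 in auto)
    then show ?thesis by simp
  qed
  show "has_bochner_integral (gaussian s) (\<lambda>z. z $ i * z $ j) (if i = j then s\<^sup>2 else 0)"
  proof -
    have "has_bochner_integral (gaussian s)
        (\<lambda>z::real^'m. \<Prod>k\<in>UNIV. (if k = i then z $ k else 1) * (if k = j then z $ k else 1))
        (\<Prod>k\<in>UNIV. if k = i then if k = j then s\<^sup>2 else 0 else if k = j then 0 else 1)"
      by (rule has_bochner_integral_gaussian_prod
            [where h="\<lambda>k x. (if k = i then x else 1) * (if k = j then x else 1)"])
         (use m0 m1 m2 in auto)
    moreover have "(\<Prod>k\<in>UNIV. if k = i then if k = j then s\<^sup>2 else 0 else if k = j then 0 else 1)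
        = (if i = j then s\<^sup>2 else 0)"
    proof (cases "i = j")
      case True
      then have "(\<Prod>k\<in>UNIV. if k = i then if k = j then s\<^sup>2 else 0 else if k = j then 0 else 1)
        = (\<Prod>k\<in>UNIV. if k = i then s\<^sup>2 else 1)"
        by (intro prod.cong) auto
      with True show ?thesis by simp
    next
      case False
      then show ?thesis by (auto intro!: prod_zero bexI[of _ i])
    qed
    ultimately show ?thesis
      by (simp add: prod.distrib)
  qed
qed

lemma prob_space_gaussian: "0 < s \<Longrightarrow> prob_space (gaussian s :: (real ^ 'm) measure)"
proof (rule prob_spaceI)
  assume "0 < s"
  from gaussian_mass[OF this, where 'm='m] have int: "integrable (gaussian s) (\<lambda>z::real^'m. 1::real)"
    and eq: "(\<integral>z. 1 \<partial>(gaussian s :: (real ^ 'm) measure)) = (1::real)"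
    by (simp_all only: has_bochner_integral_iff)
  have "(\<integral>\<^sup>+z. ennreal 1 \<partial>(gaussian s :: (real ^ 'm) measure)) = ennreal 1"
    by (subst nn_integral_eq_integral[OF int]) (simp_all only: eq, simp)
  then show "emeasure (gaussian s :: (real ^ 'm) measure) (space (gaussian s)) = 1"
    by simp
qed

lemma norm_matrix_power2: "(norm (A :: real^'m^'d))\<^sup>2 = (\<Sum>i\<in>UNIV. \<Sum>j\<in>UNIV. (A $ i $ j)\<^sup>2)"
  unfolding norm_matrix_Hilbert_Schmidt by (intro real_sqrt_pow2 sum_nonneg) auto

lemma norm_vec_power2: "(norm (x :: real^'d))\<^sup>2 = (\<Sum>i\<in>UNIV. (x $ i)\<^sup>2)"
  by (simp add: norm_vec_def L2_set_def sum_nonneg)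

text \<open>First and mixed second moments vanish, so besides |t|^2 only s^2 times the trace of A
  A^T survives, and this trace is the squared Hilbert-Schmidt norm.\<close>

lemma nn_integral_gaussian_affine_norm:
  fixes A :: "real^'m^'d"
  assumes s: "0 < s"
  shows "(\<integral>\<^sup>+z. ennreal ((norm (t + A *v z))\<^sup>2) \<partial>gaussian s) = ennreal ((norm t)\<^sup>2 + s\<^sup>2 * (norm A)\<^sup>2)"
proof -
  have expand: "(norm (t + A *v z))\<^sup>2 = (\<Sum>i\<in>UNIV. (t $ i)\<^sup>2 * 1 + (\<Sum>j\<in>UNIV. (2 * t $ i * A $ i $ j) * z $ j)
      + (\<Sum>j\<in>UNIV. \<Sum>k\<in>UNIV. (A $ i $ j * A $ i $ k) * (z $ j * z $ k)))" for z
    unfolding norm_vec_power2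
  proof (rule sum.cong[OF refl])
    fix i :: 'd
    have "(\<Sum>j\<in>UNIV. \<Sum>k\<in>UNIV. (A $ i $ j * A $ i $ k) * (z $ j * z $ k)) = (\<Sum>j\<in>UNIV. A $ i $ j * z $ j)\<^sup>2"
      by (simp add: power2_eq_square sum_product ac_simps)
    moreover have "(\<Sum>j\<in>UNIV. (2 * t $ i * A $ i $ j) * z $ j) = 2 * t $ i * (\<Sum>j\<in>UNIV. A $ i $ j * z $ j)"
      by (simp add: sum_distrib_left ac_simps)
    ultimately show "((t + A *v z) $ i)\<^sup>2 = (t $ i)\<^sup>2 * 1 + (\<Sum>j\<in>UNIV. (2 * t $ i * A $ i $ j) * z $ j)
      + (\<Sum>j\<in>UNIV. \<Sum>k\<in>UNIV. (A $ i $ j * A $ i $ k) * (z $ j * z $ k))"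
      by (simp add: matrix_vector_mult_def power2_sum)
  qed
  have "has_bochner_integral (gaussian s) (\<lambda>z. (norm (t + A *v z))\<^sup>2)
     (\<Sum>i\<in>UNIV. (t $ i)\<^sup>2 * 1 + (\<Sum>j\<in>UNIV. (2 * t $ i * A $ i $ j) * 0)
      + (\<Sum>j\<in>UNIV. \<Sum>k\<in>UNIV. (A $ i $ j * A $ i $ k) * (if j = k then s\<^sup>2 else 0)))"
    unfolding expand
    by (intro has_bochner_integral_sum has_bochner_integral_add has_bochner_integral_mult_right
        gaussian_mass[OF s] gaussian_moment1[OF s] gaussian_moment2[OF s])
  also have "(\<Sum>i\<in>UNIV. (t $ i)\<^sup>2 * 1 + (\<Sum>j\<in>UNIV. (2 * t $ i * A $ i $ j) * 0)
      + (\<Sum>j\<in>UNIV. \<Sum>k\<in>UNIV. (A $ i $ j * A $ i $ k) * (if j = k then s\<^sup>2 else 0)))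
      = (norm t)\<^sup>2 + s\<^sup>2 * (norm A)\<^sup>2"
    by (simp add: norm_vec_power2 norm_matrix_power2 sum.distrib if_distrib sum_distrib_left
        power2_eq_square[of "A $ _ $ _"] ac_simps cong: if_cong)
  finally have "has_bochner_integral (gaussian s) (\<lambda>z. (norm (t + A *v z))\<^sup>2) ((norm t)\<^sup>2 + s\<^sup>2 * (norm A)\<^sup>2)" .
  then show ?thesis
    by (simp add: has_bochner_integral_iff nn_integral_eq_integral)
qed

lemma normal_density_antimono:
  assumes "0 < s" "\<bar>x\<bar> \<le> q"
  shows "normal_density 0 s q \<le> normal_density 0 s x"
proof -
  have "x\<^sup>2 \<le> q\<^sup>2" using assms(2) by (simp add: abs_le_square_iff[symmetric])
  then show ?thesis
    using assms(1) unfolding normal_density_def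
    by (intro mult_left_mono) (simp_all add: divide_right_mono)
qed

lemma vec_normal_density_ge:
  fixes z :: "real ^ 'm"
  assumes "0 < s" "norm z \<le> q"
  shows "normal_density 0 s q ^ CARD('m) \<le> vec_normal_density s z"
proof -
  have "(\<Prod>i\<in>(UNIV::'m set). normal_density 0 s q) \<le> vec_normal_density s z"
    unfolding vec_normal_density_def
    using assms component_le_norm_cart[of z]
    by (intro prod_mono) (auto intro!: normal_density_antimono intro: order_trans)
  then show ?thesis by simp
qed

subsection \<open>The kernel of the stochastic theta method\<close>

text \<open>Strong monotonicity bounds |S x - S y| below by c |x - y|, which gives injectivity, a
  closed range and a Lipschitz inverse. Invariance of domain makes the range open, and connectedness
  makes it the whole space.\<close>

lemma strongly_monotone_homeomorphism:
  fixes S :: "'a::euclidean_space \<Rightarrow> 'a"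
  assumes cont: "continuous_on UNIV S" and c: "0 < c"
    and mono: "\<And>x y. c * (norm (x - y))\<^sup>2 \<le> (S x - S y) \<bullet> (x - y)"
  shows "bij S" and "continuous_on UNIV (inv S)"
proof -
  have lower: "c * norm (x - y) \<le> norm (S x - S y)" for x y
  proof (cases "x = y")
    case False
    have "(c * norm (x - y)) * norm (x - y) \<le> norm (S x - S y) * norm (x - y)"
      using mono[of x y] norm_cauchy_schwarz[of "S x - S y" "x - y"]
      by (simp add: power2_eq_square)
    with False show ?thesis by simp
  qed simp
  have inj: "inj S"
  proof (rule injI)
    fix x y assume "S x = S y"
    with lower[of x y] have "c * norm (x - y) \<le> 0" by simp
    with c show "x = y" by (simp add: mult_le_0_iff)
  qed
  have "open (range S)"
    using cont inj by (intro invariance_of_domain) auto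
  moreover have "closed (range S)"
    unfolding closed_sequential_limits
  proof (intro allI impI, elim conjE)
    fix y l assume y: "\<forall>n. y n \<in> range S" and lim: "y \<longlonglongrightarrow> l"
    define x where "x n = inv S (y n)" for n
    have x: "y n = S (x n)" for n
      using y by (simp add: x_def f_inv_into_f)
    have "Cauchy x"
    proof (rule metric_CauchyI)
      fix e :: real assume "0 < e"
      then have "0 < c * e" using c by simp
      with LIMSEQ_imp_Cauchy[OF lim] obtain M where M: "\<And>m n. M \<le> m \<Longrightarrow> M \<le> n \<Longrightarrow> dist (y m) (y n) < c * e"
        unfolding Cauchy_def by blast
      have "dist (x m) (x n) < e" if "M \<le> m" "M \<le> n" for m n
      proof -
        have "c * dist (x m) (x n) < c * e"
          using lower[of "x m" "x n"] M[OF that] by (simp add: dist_norm x)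
        with c show ?thesis by simp
      qed
      then show "\<exists>M. \<forall>m\<ge>M. \<forall>n\<ge>M. dist (x m) (x n) < e" by blast
    qed
    then obtain z where z: "x \<longlonglongrightarrow> z"
      using Cauchy_convergent convergent_def by blast
    have "isCont S z"
      using cont by (simp add: continuous_on_eq_continuous_at)
    from isCont_tendsto_compose[OF this z] have "y \<longlonglongrightarrow> S z"
      by (simp only: x[symmetric])
    with lim have "l = S z"
      by (rule LIMSEQ_unique)
    then show "l \<in> range S" by simp
  qed
  ultimately have "range S = UNIV"
    using clopen[of "range S"] by auto
  with inj show "bij S" by (simp add: bij_def)
  then have S_inv: "S (inv S u) = u" for u
    by (simp add: bij_is_surj surj_f_inv_f)
  have "dist (inv S u) (inv S v) \<le> (1 / c) * dist u v" for u v
    using lower[of "inv S u" "inv S v"] c by (simp add: S_inv dist_norm field_simps)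
  then have "(1 / c)-lipschitz_on UNIV (inv S)"
    using c by (intro lipschitz_onI) auto
  then show "continuous_on UNIV (inv S)"
    by (rule lipschitz_on_continuous_on)
qed

lemma emeasure_lborel_ball_eq_measure:
  "emeasure lborel (ball x r) = ennreal (measure lborel (ball x r))"
  using emeasure_lborel_ball_finite[of x r] by (intro emeasure_eq_ennreal_measure) auto

lemma continuous_on_matrix_vector_mult:
  fixes A :: "'a::topological_space \<Rightarrow> real^'m^'d"
  assumes "continuous_on X A" "continuous_on X v"
  shows "continuous_on X (\<lambda>x. A x *v v x)"
  unfolding matrix_vector_mult_def
  by (intro continuous_on_vec_lambda continuous_intros assms)

lemma continuous_on_transpose:
  fixes A :: "'a::topological_space \<Rightarrow> real^'m^'d"
  assumes "continuous_on X A"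
  shows "continuous_on X (\<lambda>x. transpose (A x))"
  unfolding transpose_def
  by (intro continuous_on_vec_lambda continuous_intros assms)

lemma pos_def_matrix_invertible:
  assumes "pos_def_matrix A"
  shows "invertible A"
  unfolding invertible_left_inverse matrix_left_invertible_ker
proof (intro allI impI)
  fix x assume "A *v x = 0"
  then have "x \<bullet> (A *v x) = 0" by simp
  with assms show "x = 0" by (auto simp: pos_def_matrix_def)
qed

lemma invertible_matrix_inv_right:
  fixes A :: "real^'n^'n"
  assumes "invertible A"
  shows "A ** matrix_inv A = mat 1"
  using assms someI_ex[of "\<lambda>B. A ** B = mat 1 \<and> B ** A = mat 1"]
  by (auto simp: invertible_def matrix_inv_def)

lemma norm_diff_scaleR_power2:
  fixes x y :: "'a::real_inner"
  shows "(norm (x - a *\<^sub>R y))\<^sup>2 = (norm x)\<^sup>2 - 2 * a * (y \<bullet> x) + a\<^sup>2 * (norm y)\<^sup>2"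
  unfolding power2_norm_eq_inner
  by (simp add: inner_diff_left inner_diff_right inner_commute[of x y] power2_eq_square algebra_simps)

locale stm_scheme =
  fixes b :: "real ^ 'd \<Rightarrow> real ^ 'd" and \<sigma> :: "real ^ 'd \<Rightarrow> real ^ 'm ^ 'd"
    and L1 L2 L3 \<tau> \<theta> :: real
  assumes b_cont: "continuous_on UNIV b" and \<sigma>_cont: "continuous_on UNIV \<sigma>"
    and L2: "0 < L2" and L3: "0 < L3"
    and one_sided: "\<And>x y. 2 * ((b x - b y) \<bullet> (x - y)) + (norm (\<sigma> x - \<sigma> y))\<^sup>2 \<le> L1 * (norm (x - y))\<^sup>2"
    and dissipative: "\<And>x. 2 * (b x \<bullet> x) + (norm (\<sigma> x))\<^sup>2 \<le> L2 - L3 * (norm x)\<^sup>2"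
    and pos_def: "\<And>x. pos_def_matrix (\<sigma> x ** transpose (\<sigma> x))"
    and inverse_cont: "continuous_on UNIV (\<lambda>x. matrix_inv (\<sigma> x ** transpose (\<sigma> x)))"
    and \<tau>: "0 < \<tau>" "\<tau> < 1"
    and \<theta>: "1 / 2 \<le> \<theta>" "\<theta> \<le> 1"
    and step: "L1 * \<theta> * \<tau> < 2"
begin

definition implicit :: "real ^ 'd \<Rightarrow> real ^ 'd" where
  "implicit x = x - (\<theta> * \<tau>) *\<^sub>R b x"

definition explicit :: "real ^ 'd \<Rightarrow> real ^ 'd" where
  "explicit x = x + ((1 - \<theta>) * \<tau>) *\<^sub>R b x"

definition update :: "real ^ 'd \<Rightarrow> real ^ 'm \<Rightarrow> real ^ 'd" where
  "update x w = inv implicit (explicit x + \<sigma> x *v w)"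

definition kernel :: "real ^ 'd \<Rightarrow> (real ^ 'd) measure" where
  "kernel x = distr (gaussian (sqrt \<tau>)) borel (update x)"

lemma implicit_cont: "continuous_on UNIV implicit"
  and explicit_cont: "continuous_on UNIV explicit"
  unfolding implicit_def explicit_def by (intro continuous_intros b_cont)+

lemma implicit_homeomorphism: "bij implicit" "continuous_on UNIV (inv implicit)"
proof -
  \<comment> \<open>The one-sided Lipschitz bound lets \<theta> \<tau> b take away at most L1
    \<theta> \<tau> / 2 from the monotonicity constant 1 of the identity.\<close>
  let ?c = "1 - L1 * \<theta> * \<tau> / 2"
  have "?c * (norm (x - y))\<^sup>2 \<le> (implicit x - implicit y) \<bullet> (x - y)" for x y
  proof -
    have "2 * ((b x - b y) \<bullet> (x - y)) \<le> L1 * (norm (x - y))\<^sup>2"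
      using one_sided[of x y] zero_le_power2[of "norm (\<sigma> x - \<sigma> y)"] by linarith
    then have "(\<theta> * \<tau>) * (2 * ((b x - b y) \<bullet> (x - y))) \<le> (\<theta> * \<tau>) * (L1 * (norm (x - y))\<^sup>2)"
      using \<theta> \<tau> by (intro mult_left_mono) auto
    moreover have "(implicit x - implicit y) \<bullet> (x - y) = (norm (x - y))\<^sup>2 - (\<theta> * \<tau>) * ((b x - b y) \<bullet> (x - y))"
      by (simp add: implicit_def power2_norm_eq_inner inner_diff_left algebra_simps)
    ultimately show ?thesis by (simp add: algebra_simps)
  qed
  moreover have "0 < ?c" using step by simp
  ultimately show "bij implicit" "continuous_on UNIV (inv implicit)"
    using strongly_monotone_homeomorphism[OF implicit_cont] by blast+
qed

lemma implicit_inv[simp]: "implicit (inv implicit u) = u" and inv_implicit[simp]: "inv implicit (implicit x) = x"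
  using implicit_homeomorphism(1) by (simp_all add: bij_def surj_f_inv_f)

lemma update_measurable[measurable]: "case_prod update \<in> borel_measurable (borel \<Otimes>\<^sub>M borel)"
proof -
  have "continuous_on UNIV (\<lambda>p. inv implicit (explicit (fst p) + \<sigma> (fst p) *v snd p))"
    by (intro continuous_on_compose2[OF implicit_homeomorphism(2)] continuous_intros
        continuous_on_matrix_vector_mult continuous_on_compose2[OF explicit_cont]
        continuous_on_compose2[OF \<sigma>_cont]) auto
  then have "(\<lambda>p. inv implicit (explicit (fst p) + \<sigma> (fst p) *v snd p)) \<in> borel_measurable borel"
    by (rule borel_measurable_continuous_onI)
  then show ?thesis
    by (simp add: update_def split_beta' borel_prod)
qed

lemma update_measurable2[measurable]: "update x \<in> borel_measurable borel"
  using measurable_Pair2[OF update_measurable, of x] by simp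

lemma kernel_measurable: "kernel \<in> borel \<rightarrow>\<^sub>M prob_algebra borel"
  unfolding kernel_def
proof (rule measurable_distr_prob_space2[where M=borel])
  show "(\<lambda>x. gaussian (sqrt \<tau>) :: (real^'m) measure) \<in> borel \<rightarrow>\<^sub>M prob_algebra borel"
    using prob_space_gaussian[of "sqrt \<tau>", where 'm='m] \<tau>
    by (intro measurable_const) (simp add: space_prob_algebra)
qed (use update_measurable in simp)

lemma sets_kernel_eq[simp]: "sets (kernel x) = sets borel"
  by (simp add: kernel_def)

lemma nn_integral_kernel:
  "h \<in> borel_measurable borel \<Longrightarrow> (\<integral>\<^sup>+y. h y \<partial>kernel x) = (\<integral>\<^sup>+w. h (update x w) \<partial>gaussian (sqrt \<tau>))"
  unfolding kernel_def by (intro nn_integral_distr) simp_all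

lemma nn_integral_implicit_norm:
  "(\<integral>\<^sup>+y. ennreal ((norm (implicit y))\<^sup>2) \<partial>kernel x) = ennreal ((norm (explicit x))\<^sup>2 + \<tau> * (norm (\<sigma> x))\<^sup>2)"
proof -
  have "implicit \<in> borel_measurable borel"
    by (rule borel_measurable_continuous_onI[OF implicit_cont])
  then show ?thesis
    using \<tau> by (subst nn_integral_kernel) (simp_all add: update_def nn_integral_gaussian_affine_norm)
qed

text \<open>\<open>\<nu>\<close> must not depend on x. All dependence on x sits in the affine
  Gaussian inside \<open>inv implicit\<close>; its law dominates a multiple of the uniform law on
  the unit ball, which is pushed through the same homeomorphism for every x. Compactness makes the
  multiple uniform.\<close>

lemma kernel_minorization:
  "\<exists>\<epsilon> \<nu>. 0 < \<epsilon> \<and> prob_space \<nu> \<and> sets \<nu> = sets borel \<and>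
    (\<forall>x\<in>cball 0 r. \<forall>A\<in>sets borel. ennreal \<epsilon> * emeasure \<nu> A \<le> emeasure (kernel x) A)"
proof -
  let ?J = "\<lambda>x. matrix_inv (\<sigma> x ** transpose (\<sigma> x))"
  \<comment> \<open>The pseudoinverse of \<open>\<sigma> x\<close>: a right inverse that depends
    continuously on x.\<close>
  define B where "B x u = transpose (\<sigma> x) *v (?J x *v u)" for x u
  have AB: "\<sigma> x *v B x u = u" for x u
    by (simp only: B_def matrix_vector_mul_assoc matrix_mul_assoc matrix_vector_mul_lid
        invertible_matrix_inv_right[OF pos_def_matrix_invertible[OF pos_def[of x]]])
  have cont_fst: "continuous_on UNIV (\<lambda>p. f (fst p))" if "continuous_on UNIV f"
    for f :: "real^'d \<Rightarrow> 'z::topological_space"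
    using that continuous_on_fst[OF continuous_on_id] by (rule continuous_on_compose2) simp
  have "continuous_on UNIV (\<lambda>p. explicit (fst p) + \<sigma> (fst p) *v snd p)"
    by (intro continuous_on_add continuous_on_matrix_vector_mult cont_fst explicit_cont \<sigma>_cont
        continuous_on_snd continuous_on_id)
  then have "bounded ((\<lambda>p. explicit (fst p) + \<sigma> (fst p) *v snd p) ` (cball 0 r \<times> cball 0 1))"
    by (intro compact_imp_bounded compact_continuous_image compact_Times compact_cball)
       (auto intro: continuous_on_subset)
  then obtain \<rho> where "\<rho> > 0" and \<rho>: "\<And>x z. x \<in> cball 0 r \<Longrightarrow> z \<in> cball 0 1 \<Longrightarrow> norm (explicit x + \<sigma> x *v z) \<le> \<rho>"
    unfolding bounded_pos by auto
  have "continuous_on UNIV (\<lambda>p. B (fst p) (snd p))"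
    unfolding B_def
    by (intro continuous_on_matrix_vector_mult continuous_on_transpose cont_fst[OF inverse_cont]
        cont_fst[OF \<sigma>_cont] continuous_on_snd continuous_on_id)
  then have "bounded ((\<lambda>p. B (fst p) (snd p)) ` (cball 0 r \<times> cball 0 (1 + \<rho>)))"
    by (intro compact_imp_bounded compact_continuous_image compact_Times compact_cball)
       (auto intro: continuous_on_subset)
  then obtain q where "q > 0" and q: "\<And>x u. x \<in> cball 0 r \<Longrightarrow> u \<in> cball 0 (1 + \<rho>) \<Longrightarrow> norm (B x u) \<le> q"
    unfolding bounded_pos by auto
  let ?B = "ball 0 1 :: (real^'d) set"
  \<comment> \<open>A lower bound for the Gaussian density on the unit ball shifted by
    \<open>B x u\<close>, where norms are at most q + 1.\<close>
  define c where "c = normal_density 0 (sqrt \<tau>) (q + 1) ^ CARD('m)"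
  have c: "0 < c" using \<tau> by (simp add: c_def normal_density_pos)
  define v where "v = measure lborel (ball 0 1 :: (real^'m) set)"
  define d where "d = measure lborel ?B"
  define e where "e = measure lborel (ball 0 (1 + \<rho>) :: (real^'d) set)"
  have pos: "0 < v" "0 < d" "0 < e"
    using content_ball_pos[of 1 "0::real^'m"] content_ball_pos[of 1 "0::real^'d"]
      content_ball_pos[of "1 + \<rho>" "0::real^'d"] \<open>\<rho> > 0\<close>
    by (simp_all add: v_def d_def e_def)
  have vol: "emeasure lborel (ball 0 1 :: (real^'m) set) = ennreal v" "emeasure lborel ?B = ennreal d"
    "emeasure lborel (ball 0 (1 + \<rho>) :: (real^'d) set) = ennreal e"
    unfolding v_def d_def e_def
    by (rule emeasure_lborel_ball_eq_measure)+
  have inv_meas[measurable]: "inv implicit \<in> borel_measurable borel"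
    by (rule borel_measurable_continuous_onI[OF implicit_homeomorphism(2)])
  define \<nu> where "\<nu> = distr (uniform_measure lborel ?B) borel (inv implicit)"
  have "prob_space (uniform_measure lborel ?B)"
    using pos by (intro prob_space_uniform_measure) (simp_all add: vol)
  then have "prob_space \<nu>"
    unfolding \<nu>_def by (intro prob_space.prob_space_distr) simp_all
  moreover have "ennreal (c * v * d / e) * emeasure \<nu> A \<le> emeasure (kernel x) A"
    if x: "x \<in> cball 0 r" and A[measurable]: "A \<in> sets borel" for x A
  proof -
    \<comment> \<open>The part of the unit ball that \<open>inv implicit\<close> sends into
      \<open>A\<close>; its relative volume is the \<open>\<nu>\<close>-mass of
      \<open>A\<close>.\<close>
    define D where "D = ?B \<inter> inv implicit -` A"
    have D[measurable]: "D \<in> sets borel"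
      unfolding D_def using measurable_sets_borel[OF inv_meas A] by auto
    define \<delta> where "\<delta> = measure lborel D"
    have D_vol: "emeasure lborel D = ennreal \<delta>"
    proof -
      have "emeasure lborel D \<le> emeasure lborel ?B"
        by (intro emeasure_mono) (auto simp: D_def)
      also have "\<dots> < \<infinity>" by (simp add: vol)
      finally show ?thesis
        unfolding \<delta>_def by (intro emeasure_eq_ennreal_measure) auto
    qed
    interpret k: prob_space "kernel x"
      using measurable_space[OF kernel_measurable, of x] by (simp add: space_prob_algebra)
    let ?f = "\<lambda>z::real^'m. ennreal (vec_normal_density (sqrt \<tau>) z)"
    have "ennreal c * ennreal v * ennreal \<delta> \<le> ennreal e * (\<integral>\<^sup>+z. ?f z * indicator D (explicit x + \<sigma> x *v z) \<partial>lborel)"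
      unfolding vol[symmetric] D_vol[symmetric]
    proof (rule affine_image_density_ge[where B="B x"])
      show "linear ((*v) (\<sigma> x))" by (rule matrix_vector_mul_linear)
      show "\<sigma> x *v B x u = u" for u by (rule AB)
      show "norm (explicit x + \<sigma> x *v z) \<le> \<rho>" if "z \<in> ball 0 1" for z
        using \<rho>[OF x, of z] that by simp
      show "ennreal c \<le> ?f (B x u + z)" if "u \<in> ball 0 (1 + \<rho>)" "z \<in> ball 0 1" for u z
      proof -
        have "norm (B x u + z) \<le> q + 1"
          using q[OF x, of u] that norm_triangle_ineq[of "B x u" z] by simp
        then show ?thesis
          unfolding c_def using \<tau> by (intro ennreal_leI vec_normal_density_ge) auto
      qed
      show "D \<in> sets borel" by (rule D)
      show "D \<subseteq> ball 0 1" by (auto simp: D_def)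
    qed simp
    also have "(\<integral>\<^sup>+z. ?f z * indicator D (explicit x + \<sigma> x *v z) \<partial>lborel) \<le> emeasure (kernel x) A"
    proof -
      have "(\<integral>\<^sup>+z. ?f z * indicator D (explicit x + \<sigma> x *v z) \<partial>lborel)
          \<le> (\<integral>\<^sup>+z. ?f z * indicator A (update x z) \<partial>lborel)"
        by (intro nn_integral_mono mult_left_mono) (auto simp: D_def update_def indicator_def)
      also have "\<dots> = (\<integral>\<^sup>+z. indicator A (update x z) \<partial>gaussian (sqrt \<tau>))"
        unfolding gaussian_def by (subst nn_integral_density) auto
      also have "\<dots> = emeasure (kernel x) A"
        using nn_integral_kernel[of "indicator A" x] by simp
      finally show ?thesis .
    qed
    finally have "ennreal c * ennreal v * ennreal \<delta> \<le> ennreal e * emeasure (kernel x) A"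
      by (simp add: mult_left_mono)
    moreover have "0 \<le> \<delta>" by (simp add: \<delta>_def)
    ultimately have "c * v * \<delta> \<le> e * measure (kernel x) A"
      using c pos by (simp add: k.emeasure_eq_measure ennreal_mult[symmetric])
    \<comment> \<open>The comparison bounds c v \<delta> by e times the kernel mass of
      \<open>A\<close>; writing \<delta> as d times the relative volume \<delta> / d produces the
      minorization constant.\<close>
    then have "(c * v * d / e) * (\<delta> / d) \<le> measure (kernel x) A"
      using pos by (simp add: field_simps)
    moreover have "emeasure \<nu> A = ennreal (\<delta> / d)"
      unfolding \<nu>_def using pos \<open>0 \<le> \<delta>\<close> measurable_sets_borel[OF inv_meas A]
      by (simp add: emeasure_distr D_def[symmetric] D_vol vol divide_ennreal)
    ultimately show ?thesis
      using c pos \<open>0 \<le> \<delta>\<close> by (simp add: k.emeasure_eq_measure ennreal_mult[symmetric])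
  qed
  moreover have "0 < c * v * d / e" using c pos by simp
  ultimately show ?thesis
    by (intro exI[of _ "c * v * d / e"] exI[of _ \<nu>]) (simp add: \<nu>_def)
qed

section \<open>Energy estimates and the geometric drift\<close>

lemma explicit_eq: "explicit x = x - (- ((1 - \<theta>) * \<tau>)) *\<^sub>R b x"
  by (simp add: explicit_def)

lemma implicit_norm_drift:
  "(norm (explicit x))\<^sup>2 + \<tau> * (norm (\<sigma> x))\<^sup>2 + \<tau> * L3 * (norm x)\<^sup>2 \<le> (norm (implicit x))\<^sup>2 + \<tau> * L2"
proof -
  \<comment> \<open>This is exactly the right side of the claim minus its left side; \<theta> \<ge>
    1/2 is needed for the last term.\<close>
  have "0 \<le> \<tau> * (L2 - L3 * (norm x)\<^sup>2 - 2 * (b x \<bullet> x) - (norm (\<sigma> x))\<^sup>2) + (2 * \<theta> - 1) * \<tau>\<^sup>2 * (norm (b x))\<^sup>2"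
    using dissipative[of x] \<tau> \<theta> by (intro add_nonneg_nonneg mult_nonneg_nonneg) auto
  then show ?thesis
    unfolding explicit_eq implicit_def norm_diff_scaleR_power2
    by (simp add: algebra_simps power2_eq_square)
qed

text \<open>Allows the drift of the Lyapunov function to be computed from the exact second moment of
  \<open>implicit\<close> under the kernel. With w = (2 \<theta> - 1 - \<eta>) \<tau>, the two
  differ by 1 + w (2 <b x, x> + |\<sigma> x|^2) - w (1 + \<eta>) \<tau> |b x|^2; at \<eta> = 2
  \<theta> - 1 this is just 1.\<close>

lemma lyapunov_le_implicit:
  assumes "\<eta> \<le> 2 * \<theta> - 1" "0 \<le> \<eta>"
  shows "stm_lyapunov b \<sigma> \<theta> \<tau> \<eta> x \<le> (norm (implicit x))\<^sup>2 + (1 + (2 * \<theta> - 1 - \<eta>) * \<tau> * L2)"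
proof -
  have "0 \<le> L3 * (norm x)\<^sup>2" using L3 by simp
  then have "0 \<le> L2 - 2 * (b x \<bullet> x) - (norm (\<sigma> x))\<^sup>2"
    using dissipative[of x] by linarith
  then have "0 \<le> ((2 * \<theta> - 1 - \<eta>) * \<tau>) * (L2 - 2 * (b x \<bullet> x) - (norm (\<sigma> x))\<^sup>2)
      + (2 * \<theta> - 1 - \<eta>) * (1 + \<eta>) * \<tau>\<^sup>2 * (norm (b x))\<^sup>2"
    using \<tau> assms
    by (intro add_nonneg_nonneg mult_nonneg_nonneg) auto
  then show ?thesis
    unfolding stm_lyapunov_def implicit_def norm_diff_scaleR_power2
    by (simp add: algebra_simps power2_eq_square)
qed

text \<open>Replacing the coefficient in V by the explicit one adds \<kappa> times the dissipated
  quantity 2 <b x, x> + |\<sigma> x|^2 and leaves - \<kappa> \<eta> \<tau> |b x|^2, because (1 -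
  \<theta>)^2 - (1 - \<theta> + \<eta>)^2 = - \<eta> (2 - 2 \<theta> + \<eta>). For \<eta> > 0 this
  remainder supplies the control of \<open>b\<close> behind the geometric rate.\<close>

lemma explicit_le_lyapunov:
  fixes \<eta> :: real
  defines "\<kappa> \<equiv> (2 - 2 * \<theta> + \<eta>) * \<tau>"
  assumes "0 \<le> \<eta>"
  shows "(norm (explicit x))\<^sup>2 + \<tau> * (norm (\<sigma> x))\<^sup>2 + 1 + \<kappa> * L3 * (norm x)\<^sup>2 + \<kappa> * \<eta> * \<tau> * (norm (b x))\<^sup>2
    \<le> stm_lyapunov b \<sigma> \<theta> \<tau> \<eta> x + \<kappa> * L2"
proof -
  have "0 \<le> \<kappa> * (L2 - L3 * (norm x)\<^sup>2 - 2 * (b x \<bullet> x) - (norm (\<sigma> x))\<^sup>2)"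
    using dissipative[of x] \<tau> \<theta> assms by (intro mult_nonneg_nonneg) auto
  then show ?thesis
    unfolding stm_lyapunov_def explicit_eq norm_diff_scaleR_power2 \<kappa>_def
    by (simp add: algebra_simps power2_eq_square)
qed

lemma lyapunov_ge_1: "\<eta> \<le> 2 * \<theta> - 1 \<Longrightarrow> 1 \<le> stm_lyapunov b \<sigma> \<theta> \<tau> \<eta> x"
  using \<tau> by (simp add: stm_lyapunov_def)

text \<open>Turns decay in |x|^2 and |b x|^2 into decay proportional to V. The growth of \<sigma> is
  bounded through dissipativity: |\<sigma> x|^2 \<le> L2 + 2 |<b x, x>|.\<close>

lemma lyapunov_le_norms:
  assumes "0 \<le> \<eta>" "\<eta> \<le> 2 * \<theta> - 1"
  shows "stm_lyapunov b \<sigma> \<theta> \<tau> \<eta> x \<le> (3 + L2) * (1 + ((norm x)\<^sup>2 + (norm (b x))\<^sup>2))"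
proof -
  let ?p = "(norm x)\<^sup>2" and ?s = "(norm (b x))\<^sup>2"
  define a where "a = (1 - \<theta> + \<eta>) * \<tau>"
  define w where "w = (2 * \<theta> - 1 - \<eta>) * \<tau>"
  have a: "0 \<le> a" "a \<le> 1" and w: "0 \<le> w" "w \<le> 1"
    unfolding a_def w_def using \<theta> \<tau> assms by (auto intro!: mult_le_one)
  have inner: "2 * \<bar>b x \<bullet> x\<bar> \<le> ?p + ?s"
    using Cauchy_Schwarz_ineq2[of "b x" x] sum_squares_bound[of "norm (b x)" "norm x"] by simp
  have "\<bar>a * (b x \<bullet> x)\<bar> \<le> \<bar>b x \<bullet> x\<bar>"
    using a by (simp add: abs_mult mult_left_le_one_le)
  then have "- (2 * a * (b x \<bullet> x)) \<le> 2 * \<bar>b x \<bullet> x\<bar>"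
    by (simp add: abs_le_iff)
  moreover have "a\<^sup>2 * ?s \<le> ?s"
    using a by (intro mult_left_le_one_le) (auto intro: power_le_one)
  ultimately have 1: "(norm (x - a *\<^sub>R b x))\<^sup>2 \<le> 2 * ?p + 2 * ?s"
    unfolding norm_diff_scaleR_power2 using inner by linarith
  have "0 \<le> L3 * ?p" using L3 by simp
  then have "(norm (\<sigma> x))\<^sup>2 \<le> L2 + 2 * \<bar>b x \<bullet> x\<bar>"
    using dissipative[of x] abs_ge_minus_self[of "b x \<bullet> x"] by linarith
  with inner have "(norm (\<sigma> x))\<^sup>2 \<le> L2 + (?p + ?s)" by linarith
  then have 2: "w * (norm (\<sigma> x))\<^sup>2 \<le> L2 + (?p + ?s)"
    using mult_left_le_one_le[of "(norm (\<sigma> x))\<^sup>2" w] w by simp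
  have "stm_lyapunov b \<sigma> \<theta> \<tau> \<eta> x \<le> 3 + L2 + 3 * (?p + ?s)"
    using 1 2 by (simp add: stm_lyapunov_def a_def w_def ac_simps)
  also have "\<dots> \<le> (3 + L2) * (1 + (?p + ?s))"
    using mult_nonneg_nonneg[of L2 "?p + ?s"] L2 by (simp add: distrib_left distrib_right)
  finally show ?thesis .
qed

lemma lyapunov_cont: "continuous_on UNIV (stm_lyapunov b \<sigma> \<theta> \<tau> \<eta>)"
  unfolding stm_lyapunov_def by (intro continuous_intros b_cont \<sigma>_cont)

lemma lyapunov_measurable[measurable]: "stm_lyapunov b \<sigma> \<theta> \<tau> \<eta> \<in> borel_measurable borel"
  by (rule borel_measurable_continuous_onI[OF lyapunov_cont])

lemma prob_space_kernel: "prob_space (kernel x)"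
  using measurable_space[OF kernel_measurable, of x] by (simp add: space_prob_algebra)

lemma lyapunov_drift:
  assumes \<eta>: "0 < \<eta>" "\<eta> \<le> 2 * \<theta> - 1"
  shows "\<exists>\<gamma> K. 0 \<le> \<gamma> \<and> \<gamma> < 1 \<and> 0 < K \<and>
    (\<forall>x. (\<integral>\<^sup>+y. ennreal (stm_lyapunov b \<sigma> \<theta> \<tau> \<eta> y) \<partial>kernel x)
      \<le> ennreal (\<gamma> * stm_lyapunov b \<sigma> \<theta> \<tau> \<eta> x + K))"
proof -
  let ?V = "stm_lyapunov b \<sigma> \<theta> \<tau> \<eta>"
  define \<kappa> where "\<kappa> = (2 - 2 * \<theta> + \<eta>) * \<tau>"
  have \<kappa>: "0 < \<kappa>" using \<theta> \<tau> \<eta> by (simp add: \<kappa>_def)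
  define c where "c = (2 * \<theta> - 1 - \<eta>) * \<tau> * L2"
  have c: "0 \<le> c" using \<theta> \<tau> \<eta> L2 by (simp add: c_def)
  \<comment> \<open>The common decay rate in |x|^2 and |b x|^2. By \<open>lyapunov_le_norms\<close>
    the decay is at least m / (3 + L2) times V minus m, which gives \<open>\<gamma>\<close> and one
    summand of \<open>K\<close>; \<open>\<kappa> * L2\<close> comes from dissipativity and
    \<open>c\<close> from comparing V with \<open>implicit\<close>.\<close>
  define m where "m = min (\<kappa> * L3) (\<kappa> * \<eta> * \<tau>)"
  have m: "0 < m" using \<kappa> L3 \<eta> \<tau> by (simp add: m_def)
  define \<gamma> where "\<gamma> = max 0 (1 - m / (3 + L2))"
  define K where "K = \<kappa> * L2 + c + m"
  have implicit_meas: "implicit \<in> borel_measurable borel"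
    by (rule borel_measurable_continuous_onI[OF implicit_cont])
  show ?thesis
  proof (rule exI[of _ \<gamma>], rule exI[of _ K], intro conjI allI)
    show "0 \<le> \<gamma>" "\<gamma> < 1" using m L2 by (auto simp: \<gamma>_def)
    show "0 < K" using m c \<kappa> L2 by (simp add: K_def add_nonneg_pos)
  next
    fix x
    let ?p = "(norm x)\<^sup>2" and ?s = "(norm (b x))\<^sup>2"
    interpret k: prob_space "kernel x" by (rule prob_space_kernel)
    have "(\<integral>\<^sup>+y. ennreal (?V y) \<partial>kernel x) \<le> (\<integral>\<^sup>+y. ennreal ((norm (implicit y))\<^sup>2) + ennreal (1 + c) \<partial>kernel x)"
    proof (rule nn_integral_mono)
      fix y
      have "?V y \<le> (norm (implicit y))\<^sup>2 + (1 + c)"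
        using lyapunov_le_implicit[of \<eta> y] \<eta> by (simp add: c_def)
      then have "ennreal (?V y) \<le> ennreal ((norm (implicit y))\<^sup>2 + (1 + c))"
        by (rule ennreal_leI)
      also have "\<dots> = ennreal ((norm (implicit y))\<^sup>2) + ennreal (1 + c)"
        using c by (intro ennreal_plus) auto
      finally show "ennreal (?V y) \<le> ennreal ((norm (implicit y))\<^sup>2) + ennreal (1 + c)" .
    qed
    also have "\<dots> = (\<integral>\<^sup>+y. ennreal ((norm (implicit y))\<^sup>2) \<partial>kernel x) + ennreal (1 + c)"
      using implicit_meas k.emeasure_space_1 by (subst nn_integral_add) (simp_all cong: measurable_cong_sets)
    also have "\<dots> = ennreal ((norm (explicit x))\<^sup>2 + \<tau> * (norm (\<sigma> x))\<^sup>2 + (1 + c))"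
      unfolding nn_integral_implicit_norm using \<tau> c by (intro ennreal_plus[symmetric]) auto
    also have "\<dots> \<le> ennreal (\<gamma> * ?V x + K)"
    proof (rule ennreal_leI)
      have "(norm (explicit x))\<^sup>2 + \<tau> * (norm (\<sigma> x))\<^sup>2 + 1 + \<kappa> * L3 * ?p + \<kappa> * \<eta> * \<tau> * ?s \<le> ?V x + \<kappa> * L2"
        using explicit_le_lyapunov[of \<eta> x] \<eta> by (simp add: \<kappa>_def)
      moreover have "m * ?p \<le> \<kappa> * L3 * ?p" "m * ?s \<le> \<kappa> * \<eta> * \<tau> * ?s"
        by (auto simp: m_def intro!: mult_right_mono)
      moreover have "m / (3 + L2) * ?V x \<le> m + (m * ?p + m * ?s)"
      proof -
        have "m / (3 + L2) * ?V x \<le> m / (3 + L2) * ((3 + L2) * (1 + (?p + ?s)))"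
          using lyapunov_le_norms[of \<eta> x] \<eta> m L2 by (intro mult_left_mono) auto
        also have "\<dots> = (m / (3 + L2) * (3 + L2)) * (1 + (?p + ?s))"
          by (simp only: mult.assoc)
        also have "m / (3 + L2) * (3 + L2) = m"
          using L2 by simp
        also have "m * (1 + (?p + ?s)) = m + (m * ?p + m * ?s)"
          by (simp add: distrib_left)
        finally show ?thesis .
      qed
      moreover have "(1 - m / (3 + L2)) * ?V x \<le> \<gamma> * ?V x"
        using lyapunov_ge_1[OF \<eta>(2), of x] by (intro mult_right_mono) (auto simp: \<gamma>_def)
      ultimately show "(norm (explicit x))\<^sup>2 + \<tau> * (norm (\<sigma> x))\<^sup>2 + (1 + c) \<le> \<gamma> * ?V x + K"
        by (simp add: K_def left_diff_distrib)
    qed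
    finally show "(\<integral>\<^sup>+y. ennreal (?V y) \<partial>kernel x) \<le> ennreal (\<gamma> * ?V x + K)" .
  qed
qed

text \<open>\<open>explicit_le_lyapunov\<close> read as a lower bound for V: its left side contains
  \<kappa> L3 |x|^2 among nonnegative terms, and \<eta> > 0 keeps \<kappa> positive even at \<theta>
  = 1.\<close>

lemma lyapunov_sublevel_bounded:
  assumes \<eta>: "0 < \<eta>" "\<eta> \<le> 2 * \<theta> - 1"
  shows "\<exists>r\<ge>0. \<forall>x. stm_lyapunov b \<sigma> \<theta> \<tau> \<eta> x \<le> R \<longrightarrow> norm x \<le> r"
proof -
  define \<kappa> where "\<kappa> = (2 - 2 * \<theta> + \<eta>) * \<tau>"
  have \<kappa>: "0 < \<kappa>" using \<theta> \<tau> \<eta> by (simp add: \<kappa>_def)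
  define r where "r = sqrt (\<bar>R\<bar> / (\<kappa> * L3) + L2 / L3)"
  show ?thesis
  proof (intro exI[of _ r] conjI allI impI)
    show "0 \<le> r" using \<kappa> L2 L3 by (simp add: r_def)
    fix x assume "stm_lyapunov b \<sigma> \<theta> \<tau> \<eta> x \<le> R"
    then have "(norm (explicit x))\<^sup>2 + \<tau> * (norm (\<sigma> x))\<^sup>2 + 1 + \<kappa> * L3 * (norm x)\<^sup>2 + \<kappa> * \<eta> * \<tau> * (norm (b x))\<^sup>2
        \<le> \<bar>R\<bar> + \<kappa> * L2"
      using explicit_le_lyapunov[of \<eta> x] \<eta> by (simp add: \<kappa>_def)
    moreover have "0 \<le> (norm (explicit x))\<^sup>2 + \<tau> * (norm (\<sigma> x))\<^sup>2" "0 \<le> \<kappa> * \<eta> * \<tau> * (norm (b x))\<^sup>2"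
      using \<kappa> \<eta> \<tau> by auto
    ultimately have "\<kappa> * L3 * (norm x)\<^sup>2 \<le> \<bar>R\<bar> + \<kappa> * L2"
      by linarith
    then have "(norm x)\<^sup>2 \<le> \<bar>R\<bar> / (\<kappa> * L3) + L2 / L3"
      using \<kappa> L3 by (simp add: field_simps)
    then show "norm x \<le> r"
      unfolding r_def by (rule real_le_rsqrt)
  qed
qed

section \<open>Invariant measures of the scheme\<close>

lemma kernel_minorized_cball:
  obtains \<epsilon> \<nu> where "minorized_kernel borel kernel (cball 0 r) \<epsilon> \<nu>"
proof -
  from kernel_minorization[of r] obtain \<epsilon> \<nu> where "0 < \<epsilon>" "prob_space \<nu>" "sets \<nu> = sets borel"
    "\<forall>x\<in>cball 0 r. \<forall>A\<in>sets borel. ennreal \<epsilon> * emeasure \<nu> A \<le> emeasure (kernel x) A"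
    by blast
  then have "minorized_kernel borel kernel (cball 0 r) \<epsilon> \<nu>"
    by (intro minorized_kernel.intro kernel_measurable) simp_all
  then show ?thesis by (rule that)
qed

lemma nn_integral_emeasure_kernel_eq:
  assumes "prob_space \<mu>" "sets \<mu> = sets borel" "A \<in> sets borel"
  shows "(\<integral>\<^sup>+x. emeasure (kernel x) A \<partial>\<mu>) = ennreal (LINT x|\<mu>. measure (kernel x) A)"
proof -
  interpret m: prob_space \<mu> by fact
  have "(\<lambda>x. measure (kernel x) A) \<in> borel_measurable borel"
    using measurable_compose[OF measurable_prob_algebraD[OF kernel_measurable]
        measurable_measure_subprob_algebra[OF assms(3)]] by simp
  then have int: "integrable \<mu> (\<lambda>x. measure (kernel x) A)"
    using assms prob_space.prob_le_1[OF prob_space_kernel]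
    by (intro m.integrable_const_bound[where B=1]) (auto cong: measurable_cong_sets)
  have "(\<integral>\<^sup>+x. emeasure (kernel x) A \<partial>\<mu>) = (\<integral>\<^sup>+x. ennreal (measure (kernel x) A) \<partial>\<mu>)"
    using finite_measure.emeasure_eq_measure prob_space.finite_measure[OF prob_space_kernel]
    by (intro nn_integral_cong) blast
  also have "\<dots> = ennreal (LINT x|\<mu>. measure (kernel x) A)"
    by (intro nn_integral_eq_integral[OF int]) simp
  finally show ?thesis .
qed

lemma invariant_prob_measure_iff:
  "invariant_prob_measure kernel \<mu> \<longleftrightarrow> prob_space \<mu> \<and> sets \<mu> = sets borel \<and>
    (\<forall>A\<in>sets borel. (\<integral>\<^sup>+x. emeasure (kernel x) A \<partial>\<mu>) = emeasure \<mu> A)"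
proof -
  have "(LINT x|\<mu>. measure (kernel x) A) = measure \<mu> A \<longleftrightarrow> (\<integral>\<^sup>+x. emeasure (kernel x) A \<partial>\<mu>) = emeasure \<mu> A"
    if \<mu>: "prob_space \<mu>" "sets \<mu> = sets borel" and A: "A \<in> sets borel" for A
  proof -
    interpret m: prob_space \<mu> by fact
    have "0 \<le> (LINT x|\<mu>. measure (kernel x) A)" by simp
    then show ?thesis
      unfolding nn_integral_emeasure_kernel_eq[OF \<mu> A] m.emeasure_eq_measure
      by simp
  qed
  then show ?thesis
    unfolding invariant_prob_measure_def by blast
qed

lemma drift_invariant:
  assumes V: "V \<in> borel_measurable borel" "g \<in> borel_measurable borel"
    and drift: "\<And>x. (\<integral>\<^sup>+y. V y \<partial>kernel x) + g x \<le> V x + ennreal D * indicator (cball 0 r) x"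
    and "0 \<le> D" "0 < c" "\<And>x. ennreal c \<le> g x" "\<And>x. V x < \<infinity>" "0 \<le> r"
  shows "\<exists>\<pi>. invariant_prob_measure kernel \<pi> \<and> (\<integral>\<^sup>+x. g x \<partial>\<pi>) < \<infinity> \<and>
    (\<forall>\<mu>. invariant_prob_measure kernel \<mu> \<longrightarrow> \<mu> = \<pi>)"
proof -
  obtain \<epsilon> \<nu> where "minorized_kernel borel kernel (cball 0 r) \<epsilon> \<nu>"
    by (rule kernel_minorized_cball)
  then interpret minorized_kernel borel kernel "cball 0 r" \<epsilon> \<nu> .
  have "cball 0 r \<noteq> {}" using \<open>0 \<le> r\<close> by simp
  from drift_unique_invariant[OF V drift \<open>0 \<le> D\<close> \<open>0 < c\<close> assms(6,7) this]
  show ?thesis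
    unfolding invariant_prob_measure_iff by (simp only: conj_assoc)
qed

lemma unique_invariant:
  "\<exists>\<pi>. invariant_prob_measure kernel \<pi> \<and> (\<forall>\<mu>. invariant_prob_measure kernel \<mu> \<longrightarrow> \<mu> = \<pi>)"
proof -
  \<comment> \<open>Outside this ball \<tau> L3 |x|^2 is at least 2 \<tau> L2, twice the constant in
    \<open>implicit_norm_drift\<close>: one half cancels that constant, the other is the
    decrease.\<close>
  define r where "r = sqrt (2 * L2 / L3)"
  have r: "0 \<le> r" "r\<^sup>2 = 2 * L2 / L3" using L2 L3 by (simp_all add: r_def)
  have pos: "0 < \<tau> * L2" using \<tau> L2 by simp
  have "implicit \<in> borel_measurable borel"
    by (rule borel_measurable_continuous_onI[OF implicit_cont])
  then have meas: "(\<lambda>x. ennreal ((norm (implicit x))\<^sup>2)) \<in> borel_measurable borel"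
    by measurable
  have drift: "(\<integral>\<^sup>+y. ennreal ((norm (implicit y))\<^sup>2) \<partial>kernel x) + ennreal (\<tau> * L2)
      \<le> ennreal ((norm (implicit x))\<^sup>2) + ennreal (2 * (\<tau> * L2)) * indicator (cball 0 r) x" for x
  proof -
    have "(norm (explicit x))\<^sup>2 + \<tau> * (norm (\<sigma> x))\<^sup>2 + \<tau> * L2
        \<le> (norm (implicit x))\<^sup>2 + 2 * (\<tau> * L2) * indicator (cball 0 r) x"
    proof (cases "norm x \<le> r")
      case True
      then have *: "indicator (cball 0 r) x = (1::real)" by simp
      have "0 \<le> \<tau> * L3 * (norm x)\<^sup>2" using \<tau> L3 by simp
      then show ?thesis
        unfolding * using implicit_norm_drift[of x] by linarith
    next
      case False
      then have "2 * L2 / L3 \<le> (norm x)\<^sup>2"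
        unfolding r(2)[symmetric] using r(1) by (intro power_mono) auto
      then have "2 * L2 \<le> L3 * (norm x)\<^sup>2"
        using L3 by (simp add: field_simps)
      then have "\<tau> * (2 * L2) \<le> \<tau> * (L3 * (norm x)\<^sup>2)"
        using \<tau> by (intro mult_left_mono) auto
      with False implicit_norm_drift[of x] show ?thesis by simp
    qed
    then have "ennreal ((norm (explicit x))\<^sup>2 + \<tau> * (norm (\<sigma> x))\<^sup>2 + \<tau> * L2)
        \<le> ennreal ((norm (implicit x))\<^sup>2 + 2 * (\<tau> * L2) * indicator (cball 0 r) x)"
      by (rule ennreal_leI)
    then show ?thesis
      unfolding nn_integral_implicit_norm using \<tau> L2
      by (auto simp: ennreal_plus[symmetric] indicator_def simp del: ennreal_plus split: if_splits)
  qed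
  show ?thesis
    using drift_invariant[OF meas borel_measurable_const drift _ pos] r(1) pos by auto
qed

text \<open>The drift criterion with cost a V produces an invariant measure that integrates V, and
  its uniqueness clause identifies the given \<open>\<mu>\<close> with it.\<close>

lemma nn_integral_lyapunov_finite:
  assumes \<eta>: "0 < \<eta>" "\<eta> \<le> 2 * \<theta> - 1" and \<mu>: "invariant_prob_measure kernel \<mu>"
  shows "(\<integral>\<^sup>+x. ennreal (stm_lyapunov b \<sigma> \<theta> \<tau> \<eta> x) \<partial>\<mu>) < \<infinity>"
proof -
  let ?V = "stm_lyapunov b \<sigma> \<theta> \<tau> \<eta>"
  obtain \<gamma> K where \<gamma>: "0 \<le> \<gamma>" "\<gamma> < 1" and K: "0 < K"
    and PV: "\<And>x. (\<integral>\<^sup>+y. ennreal (?V y) \<partial>kernel x) \<le> ennreal (\<gamma> * ?V x + K)"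
    using lyapunov_drift[OF \<eta>] by blast
  \<comment> \<open>Half of the gap 1 - \<gamma> absorbs \<open>K\<close> outside a sublevel set;
    the other half is the cost.\<close>
  define a where "a = (1 - \<gamma>) / 2"
  have a: "0 < a" "\<gamma> = 1 - 2 * a" using \<gamma> by (simp_all add: a_def field_simps)
  obtain r where r: "0 \<le> r" "\<And>x. ?V x \<le> K / a \<Longrightarrow> norm x \<le> r"
    using lyapunov_sublevel_bounded[OF \<eta>, of "K / a"] by blast
  have V1: "1 \<le> ?V x" for x by (rule lyapunov_ge_1[OF \<eta>(2)])
  have drift: "(\<integral>\<^sup>+y. ennreal (?V y) \<partial>kernel x) + ennreal (a * ?V x)
      \<le> ennreal (?V x) + ennreal K * indicator (cball 0 r) x" for x
  proof -
    have "\<gamma> * ?V x + K + a * ?V x \<le> ?V x + K * indicator (cball 0 r) x"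
    proof (cases "norm x \<le> r")
      case True
      have "0 \<le> a * ?V x" using V1[of x] a(1) by simp
      with True show ?thesis by (simp add: a(2) algebra_simps)
    next
      case False
      then have "K / a < ?V x" using r(2)[of x] by fastforce
      then have "K < a * ?V x" using a by (simp add: field_simps)
      with False show ?thesis by (simp add: a(2) algebra_simps)
    qed
    then have "ennreal (\<gamma> * ?V x + K + a * ?V x) \<le> ennreal (?V x + K * indicator (cball 0 r) x)"
      by (rule ennreal_leI)
    moreover have "ennreal (?V x + K * indicator (cball 0 r) x) = ennreal (?V x) + ennreal K * indicator (cball 0 r) x"
      using V1[of x] K by (auto simp: indicator_def)
    moreover have "ennreal (\<gamma> * ?V x + K + a * ?V x) = ennreal (\<gamma> * ?V x + K) + ennreal (a * ?V x)"
      using V1[of x] K \<gamma> a(1) by (intro ennreal_plus) auto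
    ultimately show ?thesis
      using order_trans[OF add_right_mono[OF PV[of x], of "ennreal (a * ?V x)"]] by simp
  qed
  have "\<exists>\<pi>. invariant_prob_measure kernel \<pi> \<and> (\<integral>\<^sup>+x. ennreal (a * ?V x) \<partial>\<pi>) < \<infinity> \<and>
      (\<forall>\<mu>. invariant_prob_measure kernel \<mu> \<longrightarrow> \<mu> = \<pi>)"
    by (rule drift_invariant[OF _ _ drift, where c=a])
       (use K a r V1 in \<open>auto intro!: ennreal_leI\<close>)
  with \<mu> have fin: "(\<integral>\<^sup>+x. ennreal (a * ?V x) \<partial>\<mu>) < \<infinity>"
    by blast
  have "(\<lambda>x. ennreal (?V x)) \<in> borel_measurable \<mu>"
    using \<mu> by (simp add: invariant_prob_measure_def cong: measurable_cong_sets)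
  then have "(\<integral>\<^sup>+x. ennreal (a * ?V x) \<partial>\<mu>) = ennreal a * (\<integral>\<^sup>+x. ennreal (?V x) \<partial>\<mu>)"
    using a V1 by (simp add: ennreal_mult' nn_integral_cmult)
  with fin a show ?thesis
    by (auto simp: ennreal_mult_less_top)
qed

end

subsection \<open>The chain driven by a Wiener process\<close>

locale stm_wiener = stm_scheme b \<sigma> L1 L2 L3 \<tau> \<theta> + standard_wiener_process M F W
  for M :: "'w measure" and F :: "real \<Rightarrow> 'w measure" and W :: "real \<Rightarrow> 'w \<Rightarrow> real ^ 'm"
    and b :: "real ^ 'd \<Rightarrow> real ^ 'd" and \<sigma> :: "real ^ 'd \<Rightarrow> real ^ 'm ^ 'd"
    and L1 L2 L3 \<tau> \<theta> :: real
begin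

definition increment :: "nat \<Rightarrow> 'w \<Rightarrow> real ^ 'm" where
  "increment n \<omega> = W (real (Suc n) * \<tau>) \<omega> - W (real n * \<tau>) \<omega>"

text \<open>An everywhere defined version that is adapted by construction.
  \<open>stm_process\<close> gives measurability for \<open>M\<close> and equations almost surely,
  while independence of the next increment refers to the filtration.\<close>

primrec adapted_chain :: "real ^ 'd \<Rightarrow> nat \<Rightarrow> 'w \<Rightarrow> real ^ 'd" where
  "adapted_chain x0 0 \<omega> = x0"
| "adapted_chain x0 (Suc n) \<omega> = update (adapted_chain x0 n \<omega>) (increment n \<omega>)"

lemma time_le: "0 \<le> real n * \<tau>" "real n * \<tau> < real (Suc n) * \<tau>" "real (Suc n) * \<tau> - real n * \<tau> = \<tau>"
  using \<tau> by (simp_all add: algebra_simps)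

lemma F_mono_measurable:
  assumes "0 \<le> s" "s \<le> t" "f \<in> measurable (F s) N"
  shows "f \<in> measurable (F t) N"
proof -
  have "space (F s) = space (F t)"
    using subalgebra_F[of s] subalgebra_F[of t] assms by (simp add: subalgebra_def)
  then have "subalgebra (F t) (F s)"
    using F_mono[of s t] assms by (simp add: subalgebra_def)
  then show ?thesis
    using assms(3) by (rule measurable_from_subalg)
qed

lemma increment_measurable_F: "increment n \<in> borel_measurable (F (real (Suc n) * \<tau>))"
proof -
  have "W (real n * \<tau>) \<in> borel_measurable (F (real (Suc n) * \<tau>))"
    by (rule F_mono_measurable[OF time_le(1) less_imp_le[OF time_le(2)] adapted[OF time_le(1)]])
  moreover have "W (real (Suc n) * \<tau>) \<in> borel_measurable (F (real (Suc n) * \<tau>))"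
    by (rule adapted[OF time_le(1)])
  ultimately show ?thesis
    unfolding increment_def by measurable
qed

lemma increment_measurable[measurable]: "increment n \<in> borel_measurable M"
  using measurable_from_subalg[OF subalgebra_F[OF time_le(1)] increment_measurable_F] .

lemma adapted_chain_measurable_F: "adapted_chain x0 n \<in> borel_measurable (F (real n * \<tau>))"
proof (induction n)
  case 0
  show ?case by simp
next
  case (Suc n)
  have "adapted_chain x0 n \<in> borel_measurable (F (real (Suc n) * \<tau>))"
    by (rule F_mono_measurable[OF time_le(1) less_imp_le[OF time_le(2)] Suc])
  from measurable_compose[OF measurable_Pair[OF this increment_measurable_F] update_measurable]
  show ?case by simp
qed

lemma adapted_chain_measurable[measurable]: "adapted_chain x0 n \<in> borel_measurable M"
  using measurable_from_subalg[OF subalgebra_F[OF time_le(1)] adapted_chain_measurable_F] .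

lemma distr_increment: "distr M borel (increment n) = gaussian (sqrt \<tau>)"
proof -
  have "distr M lborel (increment n) = gaussian (sqrt \<tau>)"
    using distributed_distr_eq_density[OF increment_normal[OF time_le(1,2)], of n, unfolded time_le(3)]
    by (simp only: increment_def[abs_def] gaussian_def vec_normal_density_def)
  moreover have "distr M lborel (increment n) = distr M borel (increment n)"
    by (rule distr_cong) auto
  ultimately show ?thesis by simp
qed

text \<open>The state is known at time n \<tau> and the increment is independent of that past;
  agreement on rectangles determines the joint law.\<close>

lemma distr_chain_increment:
  "distr M (borel \<Otimes>\<^sub>M borel) (\<lambda>\<omega>. (adapted_chain x0 n \<omega>, increment n \<omega>))
    = distr M borel (adapted_chain x0 n) \<Otimes>\<^sub>M gaussian (sqrt \<tau>)"
proof (rule pair_measure_eqI[symmetric])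
  let ?X = "adapted_chain x0 n" and ?F = "F (real n * \<tau>)"
  show "sigma_finite_measure (distr M borel ?X)"
    by (intro prob_space_imp_sigma_finite prob_space_distr) measurable
  show "sigma_finite_measure (gaussian (sqrt \<tau>) :: (real ^ 'm) measure)"
    using \<tau> by (intro prob_space_imp_sigma_finite prob_space_gaussian) simp
  show "sets (distr M borel ?X \<Otimes>\<^sub>M gaussian (sqrt \<tau>)) =
      sets (distr M (borel \<Otimes>\<^sub>M borel) (\<lambda>\<omega>. (?X \<omega>, increment n \<omega>)))"
    by (simp cong: sets_pair_measure_cong)
  fix A B assume "A \<in> sets (distr M borel ?X)" "B \<in> sets (gaussian (sqrt \<tau>) :: (real ^ 'm) measure)"
  then have A[measurable]: "A \<in> sets borel" and B[measurable]: "B \<in> sets borel" by simp_all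
  have "space ?F = space M"
    using subalgebra_F[OF time_le(1), of n] by (simp add: subalgebra_def)
  then have "?X -` A \<inter> space M \<in> sets ?F"
    using measurable_sets[OF adapted_chain_measurable_F[of x0 n] A] by simp
  moreover have "increment n -` B \<inter> space M \<in> sets (vimage_algebra (space M) (increment n) borel)"
    using B by (rule in_vimage_algebra)
  moreover have "indep_set (sets ?F) (sets (vimage_algebra (space M) (increment n) borel))"
    using increment_indep[OF time_le(1,2), of n] by (simp add: increment_def[abs_def])
  ultimately have "prob ((?X -` A \<inter> space M) \<inter> (increment n -` B \<inter> space M))
      = prob (?X -` A \<inter> space M) * prob (increment n -` B \<inter> space M)"
    by (intro indep_setD)
  moreover have "(\<lambda>\<omega>. (?X \<omega>, increment n \<omega>)) -` (A \<times> B) \<inter> space M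
      = (?X -` A \<inter> space M) \<inter> (increment n -` B \<inter> space M)"
    by auto
  ultimately show "emeasure (distr M borel ?X) A * emeasure (gaussian (sqrt \<tau>)) B
      = emeasure (distr M (borel \<Otimes>\<^sub>M borel) (\<lambda>\<omega>. (?X \<omega>, increment n \<omega>))) (A \<times> B)"
    unfolding distr_increment[of n, symmetric]
    by (simp add: emeasure_distr emeasure_eq_measure ennreal_mult)
qed

text \<open>The Markov property: under the product law Fubini integrates out the increment with the
  state frozen.\<close>

lemma adapted_chain_joint:
  assumes [measurable]: "A \<in> sets borel" "B \<in> sets borel"
  shows "emeasure M {\<omega> \<in> space M. adapted_chain x0 n \<omega> \<in> B \<and> adapted_chain x0 (Suc n) \<omega> \<in> A}
    = (\<integral>\<^sup>+x. indicator B x * emeasure (kernel x) A \<partial>distr M borel (adapted_chain x0 n))"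
proof -
  let ?X = "adapted_chain x0 n"
  let ?h = "\<lambda>p. indicator B (fst p) * indicator A (update (fst p) (snd p)) :: ennreal"
  interpret g: prob_space "gaussian (sqrt \<tau>) :: (real ^ 'm) measure"
    using \<tau> by (intro prob_space_gaussian) simp
  have upd: "(\<lambda>p. update (fst p) (snd p)) \<in> borel_measurable (borel \<Otimes>\<^sub>M borel)"
    using update_measurable by (simp add: split_beta')
  have "(\<lambda>p. indicator A (update (fst p) (snd p)) :: ennreal) \<in> borel_measurable (borel \<Otimes>\<^sub>M borel)"
    using assms(1) by (rule measurable_compose[OF upd borel_measurable_indicator])
  then have h: "?h \<in> borel_measurable (borel \<Otimes>\<^sub>M borel)"
    by measurable
  have "emeasure M {\<omega> \<in> space M. adapted_chain x0 n \<omega> \<in> B \<and> adapted_chain x0 (Suc n) \<omega> \<in> A}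
      = (\<integral>\<^sup>+\<omega>. indicator {\<omega> \<in> space M. adapted_chain x0 n \<omega> \<in> B \<and> adapted_chain x0 (Suc n) \<omega> \<in> A} \<omega> \<partial>M)"
    by (intro nn_integral_indicator[symmetric]) measurable
  also have "\<dots> = (\<integral>\<^sup>+\<omega>. ?h (?X \<omega>, increment n \<omega>) \<partial>M)"
    by (intro nn_integral_cong) (auto simp: indicator_def)
  also have "\<dots> = (\<integral>\<^sup>+p. ?h p \<partial>distr M (borel \<Otimes>\<^sub>M borel) (\<lambda>\<omega>. (?X \<omega>, increment n \<omega>)))"
    using h by (intro nn_integral_distr[symmetric]) measurable
  also have "distr M (borel \<Otimes>\<^sub>M borel) (\<lambda>\<omega>. (?X \<omega>, increment n \<omega>))
      = distr M borel ?X \<Otimes>\<^sub>M gaussian (sqrt \<tau>)"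
    by (rule distr_chain_increment)
  also have "(\<integral>\<^sup>+p. ?h p \<partial>(distr M borel ?X \<Otimes>\<^sub>M gaussian (sqrt \<tau>)))
      = (\<integral>\<^sup>+x. \<integral>\<^sup>+w. ?h (x, w) \<partial>gaussian (sqrt \<tau>) \<partial>distr M borel ?X)"
    using h by (intro g.nn_integral_fst[symmetric]) (simp cong: measurable_cong_sets sets_pair_measure_cong)
  also have "\<dots> = (\<integral>\<^sup>+x. indicator B x * emeasure (kernel x) A \<partial>distr M borel ?X)"
  proof (rule nn_integral_cong)
    fix x
    have "(\<integral>\<^sup>+w. ?h (x, w) \<partial>gaussian (sqrt \<tau>)) = indicator B x * (\<integral>\<^sup>+w. indicator A (update x w) \<partial>gaussian (sqrt \<tau>))"
      by (subst nn_integral_cmult[symmetric]) auto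
    also have "(\<integral>\<^sup>+w. indicator A (update x w) \<partial>gaussian (sqrt \<tau>)) = emeasure (kernel x) A"
      using nn_integral_kernel[of "indicator A" x] by simp
    finally show "(\<integral>\<^sup>+w. ?h (x, w) \<partial>gaussian (sqrt \<tau>)) = indicator B x * emeasure (kernel x) A" .
  qed
  finally show ?thesis .
qed

text \<open>Injectivity of \<open>implicit\<close> turns the implicit equation into
  \<open>update\<close>, so all solutions agree; each step adds one null set.\<close>

lemma stm_process_AE_eq:
  assumes X: "stm_process M W b \<sigma> \<theta> \<tau> x0 X"
  shows "AE \<omega> in M. X n \<omega> = adapted_chain x0 n \<omega>"
proof (induction n)
  case 0
  then show ?case using X by (simp add: stm_process_def)
next
  case (Suc n)
  have "AE \<omega> in M. X (Suc n) \<omega> = X n \<omega> + ((1 - \<theta>) * \<tau>) *\<^sub>R b (X n \<omega>) + (\<theta> * \<tau>) *\<^sub>R b (X (Suc n) \<omega>)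
      + \<sigma> (X n \<omega>) *v increment n \<omega>"
    using X by (simp add: stm_process_def increment_def)
  with Suc show ?case
  proof eventually_elim
    case (elim \<omega>)
    have "implicit (X (Suc n) \<omega>) = explicit (X n \<omega>) + \<sigma> (X n \<omega>) *v increment n \<omega>"
      unfolding implicit_def explicit_def using elim(2) by (simp add: algebra_simps)
    then have "X (Suc n) \<omega> = update (X n \<omega>) (increment n \<omega>)"
      unfolding update_def by (metis inv_implicit)
    with elim(1) show ?case by simp
  qed
qed

lemma stm_process_measurable: "stm_process M W b \<sigma> \<theta> \<tau> x0 X \<Longrightarrow> X n \<in> borel_measurable M"
  by (simp add: stm_process_def)

lemma distr_stm_process:
  assumes X: "stm_process M W b \<sigma> \<theta> \<tau> x0 X"
  shows "distr M borel (X n) = distr M borel (adapted_chain x0 n)"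
  using stm_process_AE_eq[OF X] stm_process_measurable[OF X] by (intro distr_cong_AE) auto

lemma stm_process_joint:
  assumes X: "stm_process M W b \<sigma> \<theta> \<tau> x0 X" and [measurable]: "A \<in> sets borel" "B \<in> sets borel"
  shows "emeasure M {\<omega> \<in> space M. X n \<omega> \<in> B \<and> X (Suc n) \<omega> \<in> A}
    = (\<integral>\<^sup>+x. indicator B x * emeasure (kernel x) A \<partial>distr M borel (X n))"
proof -
  note [measurable] = stm_process_measurable[OF X]
  have "emeasure M {\<omega> \<in> space M. X n \<omega> \<in> B \<and> X (Suc n) \<omega> \<in> A}
      = emeasure M {\<omega> \<in> space M. adapted_chain x0 n \<omega> \<in> B \<and> adapted_chain x0 (Suc n) \<omega> \<in> A}"
  proof (rule emeasure_eq_AE)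
    show "AE \<omega> in M. \<omega> \<in> {\<omega> \<in> space M. X n \<omega> \<in> B \<and> X (Suc n) \<omega> \<in> A} \<longleftrightarrow>
        \<omega> \<in> {\<omega> \<in> space M. adapted_chain x0 n \<omega> \<in> B \<and> adapted_chain x0 (Suc n) \<omega> \<in> A}"
      using stm_process_AE_eq[OF X, of n] stm_process_AE_eq[OF X, of "Suc n"]
      by eventually_elim (simp del: adapted_chain.simps)
  qed measurable
  then show ?thesis
    unfolding adapted_chain_joint[OF assms(2,3)] distr_stm_process[OF X] .
qed

lemma measure_kernel_measurable: "A \<in> sets borel \<Longrightarrow> (\<lambda>x. measure (kernel x) A) \<in> borel_measurable borel"
  using measurable_compose[OF measurable_prob_algebraD[OF kernel_measurable]
      measurable_measure_subprob_algebra] by blast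

lemma transition_kernel_stm:
  assumes X: "\<And>x0. stm_process M W b \<sigma> \<theta> \<tau> x0 (X x0)"
  shows "transition_kernel M X kernel"
  unfolding transition_kernel_def
proof (intro conjI allI ballI kernel_measurable)
  fix x0 n and A B :: "(real ^ 'd) set" assume [measurable]: "A \<in> sets borel" "B \<in> sets borel"
  let ?\<mu> = "distr M borel (X x0 n)"
  interpret d: prob_space ?\<mu>
    using stm_process_measurable[OF X] by (rule prob_space_distr)
  have [measurable]: "(\<lambda>x. measure (kernel x) A) \<in> borel_measurable borel"
    by (rule measure_kernel_measurable) fact
  have int: "integrable ?\<mu> (\<lambda>x. indicator B x *\<^sub>R measure (kernel x) A)"
    using prob_space.prob_le_1[OF prob_space_kernel]
    by (intro d.integrable_const_bound[where B=1]) (auto simp: indicator_def)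
  have "ennreal (measure M {\<omega> \<in> space M. X x0 n \<omega> \<in> B \<and> X x0 (Suc n) \<omega> \<in> A})
      = (\<integral>\<^sup>+x. indicator B x * emeasure (kernel x) A \<partial>?\<mu>)"
    using stm_process_joint[OF X, of A B x0 n] by (simp add: emeasure_eq_measure)
  also have "\<dots> = (\<integral>\<^sup>+x. ennreal (indicator B x *\<^sub>R measure (kernel x) A) \<partial>?\<mu>)"
    using finite_measure.emeasure_eq_measure[OF prob_space.finite_measure[OF prob_space_kernel]]
    by (intro nn_integral_cong) (simp add: indicator_def)
  also have "\<dots> = ennreal (LINT x:B|?\<mu>. measure (kernel x) A)"
    unfolding set_lebesgue_integral_def by (intro nn_integral_eq_integral[OF int]) simp
  finally show "measure M {\<omega> \<in> space M. X x0 n \<omega> \<in> B \<and> X x0 (Suc n) \<omega> \<in> A} = (LINT x:B|?\<mu>. measure (kernel x) A)"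
    by (subst (asm) ennreal_inj) (auto simp: set_lebesgue_integral_def)
qed

lemma nn_integral_stm_process_Suc:
  assumes X: "stm_process M W b \<sigma> \<theta> \<tau> x0 X" and h: "h \<in> borel_measurable borel"
  shows "(\<integral>\<^sup>+x. h x \<partial>distr M borel (X (Suc n))) = (\<integral>\<^sup>+x. \<integral>\<^sup>+y. h y \<partial>kernel x \<partial>distr M borel (X n))"
proof -
  note [measurable] = stm_process_measurable[OF X]
  have K: "kernel \<in> distr M borel (X n) \<rightarrow>\<^sub>M subprob_algebra borel"
    using measurable_prob_algebraD[OF kernel_measurable] by (simp cong: measurable_cong_sets)
  have ne: "space (distr M borel (X n)) \<noteq> {}" by simp
  have "distr M borel (X (Suc n)) = distr M borel (X n) \<bind> kernel"
  proof (rule measure_eqI)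
    show sets_eq: "sets (distr M borel (X (Suc n))) = sets (distr M borel (X n) \<bind> kernel)"
      by (simp add: sets_bind[OF sets_kernel[OF K] ne])
    fix A assume "A \<in> sets (distr M borel (X (Suc n)))"
    then have [measurable]: "A \<in> sets borel" by simp
    have "emeasure (distr M borel (X (Suc n))) A = emeasure M {\<omega> \<in> space M. X n \<omega> \<in> UNIV \<and> X (Suc n) \<omega> \<in> A}"
      by (subst emeasure_distr) (auto intro!: arg_cong[where f="emeasure M"])
    also have "\<dots> = (\<integral>\<^sup>+x. emeasure (kernel x) A \<partial>distr M borel (X n))"
      by (subst stm_process_joint[OF X]) simp_all
    also have "\<dots> = emeasure (distr M borel (X n) \<bind> kernel) A"
      by (rule emeasure_bind[OF ne K, symmetric]) fact
    finally show "emeasure (distr M borel (X (Suc n))) A = emeasure (distr M borel (X n) \<bind> kernel) A" .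
  qed
  then show ?thesis
    by (simp add: nn_integral_bind[OF h K])
qed

theorem geometrically_ergodic_stm:
  assumes X: "\<And>x0. stm_process M W b \<sigma> \<theta> \<tau> x0 (X x0)"
    and \<pi>: "invariant_prob_measure kernel \<pi>" and \<eta>: "0 < \<eta>" "\<eta> \<le> 2 * \<theta> - 1"
  shows "geometrically_ergodic M X \<pi> (stm_lyapunov b \<sigma> \<theta> \<tau> \<eta>)"
proof -
  let ?V = "stm_lyapunov b \<sigma> \<theta> \<tau> \<eta>"
  obtain \<gamma> K where \<gamma>: "0 \<le> \<gamma>" "\<gamma> < 1" and K: "0 < K"
    and PV: "\<And>x. (\<integral>\<^sup>+y. ennreal (?V y) \<partial>kernel x) \<le> ennreal (\<gamma> * ?V x + K)"
    using lyapunov_drift[OF \<eta>] by blast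
  \<comment> \<open>Any value above 2 K / (1 - \<gamma>) serves; the small set is then a ball
    containing the sublevel set at height \<open>R\<close>.\<close>
  define R where "R = 3 * K / (1 - \<gamma>)"
  have R: "2 * K < (1 - \<gamma>) * R" using \<gamma> K by (simp add: R_def)
  obtain r where r: "0 \<le> r" "\<And>x. ?V x \<le> R \<Longrightarrow> norm x \<le> r"
    using lyapunov_sublevel_bounded[OF \<eta>, of R] by blast
  obtain \<epsilon> \<nu> where m: "minorized_kernel borel kernel (cball 0 r) \<epsilon> \<nu>"
    by (rule kernel_minorized_cball)
  have "harris_kernel borel kernel (cball 0 r) \<epsilon> \<nu> ?V \<gamma> K R"
    using \<gamma> K R r PV lyapunov_ge_1[OF \<eta>(2)]
    by (intro harris_kernel.intro[OF m] harris_kernel_axioms.intro lyapunov_measurable) auto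
  then interpret harris_kernel borel kernel "cball 0 r" \<epsilon> \<nu> ?V \<gamma> K R .
  have p: "prob_space \<pi>" "sets \<pi> = sets borel"
    and inv: "\<And>A. A \<in> sets borel \<Longrightarrow> (\<integral>\<^sup>+x. emeasure (kernel x) A \<partial>\<pi>) = emeasure \<pi> A"
    using \<pi> unfolding invariant_prob_measure_iff by auto
  note V_fin = nn_integral_lyapunov_finite[OF \<eta> \<pi>]
  have V_int: "integrable \<pi> ?V"
    using p V_fin lyapunov_ge_1[OF \<eta>(2)]
    by (intro integrableI_nonneg AE_I2) (auto intro: order_trans[OF zero_le_one] cong: measurable_cong_sets)
  obtain \<rho> L where \<rho>: "0 < \<rho>" "\<rho> < 1" and L: "0 < L"
    and conv: "\<And>f x n. f \<in> borel_measurable borel \<Longrightarrow> (\<And>x. \<bar>f x\<bar> \<le> ?V x) \<Longrightarrow>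
      \<bar>(kernel_op kernel ^^ n) f x - (\<integral>y. f y \<partial>\<pi>)\<bar> \<le> L * \<rho> ^ n * ?V x"
    using geometric_ergodicity[OF p V_fin inv] by (metis UNIV_I space_borel)
  show ?thesis
    unfolding geometrically_ergodic_def
  proof (rule exI[of _ \<rho>], rule exI[of _ L], intro conjI ballI impI allI \<rho> L)
    fix f :: "real ^ 'd \<Rightarrow> real" assume f: "f \<in> borel_measurable borel" and le: "\<forall>x. \<bar>f x\<bar> \<le> ?V x"
    then have le1: "\<And>x. \<bar>f x\<bar> \<le> 1 * ?V x" by simp
    show "integrable \<pi> f"
      by (rule integrable_dominated[OF p(2) V_int f le1])
    fix x0 n
    note Xm = stm_process_measurable[OF X]
    have law_0: "distr M borel (X x0 0) = return borel x0"
    proof -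
      have "distr M borel (X x0 0) = distr M borel (\<lambda>_. x0)"
        using X[of x0] Xm by (intro distr_cong_AE) (auto simp: stm_process_def)
      also have "\<dots> = return borel x0"
        by (rule distr_const) simp
      finally show ?thesis .
    qed
    note law = integrable_chain integral_chain
    have law_int: "integrable (distr M borel (X x0 n)) f"
      and law_eq: "(\<integral>y. f y \<partial>distr M borel (X x0 n)) = (kernel_op kernel ^^ n) f x0"
      using law[of "\<lambda>n. distr M borel (X x0 n)", OF _ law_0 _ nn_integral_stm_process_Suc[OF X]
          prob_space_distr[OF Xm] f le1 zero_le_one] by auto
    show "integrable M (\<lambda>\<omega>. f (X x0 n \<omega>))"
      using law_int f Xm by (simp add: integrable_distr_eq)
    have "(LINT \<omega>|M. f (X x0 n \<omega>)) = (kernel_op kernel ^^ n) f x0"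
      using law_eq f Xm by (simp add: integral_distr)
    then show "\<bar>(LINT \<omega>|M. f (X x0 n \<omega>)) - (LINT y|\<pi>. f y)\<bar> \<le> L * \<rho> ^ n * ?V x0"
      using conv[OF f, of n x0] le by simp
  qed
qed

end

lemma continuously_differentiable_continuous_on:
  "continuously_differentiable f \<Longrightarrow> continuous_on UNIV f"
  unfolding continuously_differentiable_def
  by (blast intro: continuous_at_imp_continuous_on dest: has_derivative_continuous)

theorem theorem2:
  fixes M :: "'w measure" and F :: "real \<Rightarrow> 'w measure"
    and W :: "real \<Rightarrow> 'w \<Rightarrow> real ^ 'm"
    and b :: "real ^ 'd \<Rightarrow> real ^ 'd" and \<sigma> :: "real ^ 'd \<Rightarrow> real ^ 'm ^ 'd"
    and L1 L2 L3 \<tau> \<theta> :: real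
    and X :: "real ^ 'd \<Rightarrow> nat \<Rightarrow> 'w \<Rightarrow> real ^ 'd"
  assumes "standard_wiener_process M F W"
    and "continuous_on UNIV b" and "continuous_on UNIV \<sigma>"
    and "L2 > 0" and "L3 > 0"
    and "\<And>x y. 2 * ((b x - b y) \<bullet> (x - y)) + (norm (\<sigma> x - \<sigma> y))\<^sup>2 \<le> L1 * (norm (x - y))\<^sup>2"
    and "\<And>x. 2 * (b x \<bullet> x) + (norm (\<sigma> x))\<^sup>2 \<le> L2 - L3 * (norm x)\<^sup>2"
    and "\<And>x. pos_def_matrix (\<sigma> x ** transpose (\<sigma> x))"
    and "continuously_differentiable b"
    and "continuously_differentiable (\<lambda>x. matrix_inv (\<sigma> x ** transpose (\<sigma> x)))"
    and "0 < \<tau>" and "\<tau> < 1"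
    and "1 / 2 \<le> \<theta>" and "\<theta> \<le> 1"
    and "L1 * \<theta> * \<tau> < 2"
    and "\<And>x0. stm_process M W b \<sigma> \<theta> \<tau> x0 (X x0)"
  shows "(\<theta> = 1 / 2 \<longrightarrow> uniquely_ergodic M X) \<and>
    (1 / 2 < \<theta> \<longrightarrow>
      (\<exists>\<pi>. unique_invariant_prob_measure M X \<pi> \<and>
        (\<forall>\<eta>. 0 < \<eta> \<and> \<eta> \<le> 2 * \<theta> - 1 \<longrightarrow>
          geometrically_ergodic M X \<pi> (stm_lyapunov b \<sigma> \<theta> \<tau> \<eta>))))"
proof -
  have "stm_scheme b \<sigma> L1 L2 L3 \<tau> \<theta>"
    by (intro stm_scheme.intro assms continuously_differentiable_continuous_on)
  then interpret stm_wiener M F W b \<sigma> L1 L2 L3 \<tau> \<theta>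
    using assms(1) by (intro stm_wiener.intro)
  \<comment> \<open>\<open>\<pi>\<close> is fixed before \<open>\<eta>\<close>: the Lyapunov
    function varies with \<open>\<eta>\<close>, the invariant measure does not.\<close>
  obtain \<pi> where \<pi>: "invariant_prob_measure kernel \<pi>"
    and unique: "\<And>\<mu>. invariant_prob_measure kernel \<mu> \<Longrightarrow> \<mu> = \<pi>"
    using unique_invariant by blast
  have inv: "unique_invariant_prob_measure M X \<pi>"
    unfolding unique_invariant_prob_measure_def
    using transition_kernel_stm[OF assms(16)] \<pi> unique by blast
  have "geometrically_ergodic M X \<pi> (stm_lyapunov b \<sigma> \<theta> \<tau> \<eta>)" if "0 < \<eta> \<and> \<eta> \<le> 2 * \<theta> - 1" for \<eta>
    using that by (intro geometrically_ergodic_stm[OF assms(16) \<pi>]) auto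
  with inv show ?thesis
    unfolding uniquely_ergodic_def by blast
qed

end
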